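(* Let $\delta$ be a Berkeley cardinal and let $\langle\mathcal{M}_\delta,\mathcal{R}\rangle$ be the associated potentialist system. Then $\mathcal{M}_\delta$ provides a potentialist account of the universe $V$: every world $M\in\mathcal{M}_\delta$ (as $\langle M,\in\rangle$) is a substructure of $\langle V,\in\rangle$, and for every $M\in\mathcal{M}_\delta$ and every set $a$ there is $N\in\mathcal{M}_\delta$ with $M\mathcal{R}N$ and $a\in N$.
   Context: Background theory: ZF (no Axiom of Choice). Berkeley cardinal: a cardinal $\delta$ is Berkeley if for every transitive set $M$ with $\delta\in M$ and every ordinal $\eta<\delta$ there is a non-trivial elementary embedding $j:M\to M$ (of $\langle M,\in\rangle$) with $\eta<\mathrm{crit}(j)<\delta$; non-trivial means $j$ is not the identity on the ordinals. The system: $\mathcal{M}_\delta$ is the class of all transitive sets $M$ with $\delta\in M$ (the "worlds", viewed as structures $\langle M,\in\rangle$). For $M,N\in\mathcal{M}_\delta$, $M\mathcal{R}N$ ("$M$ accesses $N$") iff $M\subseteq N$ and for every elementary embedding $j:N\to N$ (trivial or not), the restriction $j\restriction M$ is an elementary embedding from $M$ to $M$. *)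

theory Defs
  imports Main
begin

text \<open>
  The background theory ZF is rendered by its models: a type \<open>'v\<close> with a binary relation satisfying
  the axioms of first-order ZF. Separation and Replacement range over first-order formulas with
  parameters only. Schemas over arbitrary HOL predicates would be the second-order axioms, and since
  HOL has a choice operator these would make every such universe satisfy the Axiom of Choice, hence
  contain no Berkeley cardinals.
\<close>

datatype fm = Mem nat nat | Eq nat nat | Neg fm | Conj fm fm | Ex nat fm

primrec holds :: "('v \<Rightarrow> 'v \<Rightarrow> bool) \<Rightarrow> fm \<Rightarrow> (nat \<Rightarrow> 'v) \<Rightarrow> bool" where
  "holds E (Mem i j) e \<longleftrightarrow> E (e i) (e j)"
| "holds E (Eq i j) e \<longleftrightarrow> e i = e j"
| "holds E (Neg p) e \<longleftrightarrow> \<not> holds E p e"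
| "holds E (Conj p q) e \<longleftrightarrow> holds E p e \<and> holds E q e"
| "holds E (Ex i p) e \<longleftrightarrow> (\<exists>x. holds E p (e(i := x)))"

class zf =
  fixes mem :: "'a \<Rightarrow> 'a \<Rightarrow> bool"  (infix "\<^bold>\<in>" 50)
  assumes extensionality: "(\<And>z. z \<^bold>\<in> x \<longleftrightarrow> z \<^bold>\<in> y) \<Longrightarrow> x = y"
    and foundation: "z \<^bold>\<in> x \<Longrightarrow> \<exists>y. y \<^bold>\<in> x \<and> \<not> (\<exists>z. z \<^bold>\<in> y \<and> z \<^bold>\<in> x)"
    and pairing: "\<exists>p. \<forall>z. z \<^bold>\<in> p \<longleftrightarrow> z = x \<or> z = y"
    and union: "\<exists>u. \<forall>z. z \<^bold>\<in> u \<longleftrightarrow> (\<exists>y. y \<^bold>\<in> x \<and> z \<^bold>\<in> y)"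
    and power_set: "\<exists>p. \<forall>z. z \<^bold>\<in> p \<longleftrightarrow> (\<forall>w. w \<^bold>\<in> z \<longrightarrow> w \<^bold>\<in> x)"
    and infinity: "\<exists>x. (\<exists>z. z \<^bold>\<in> x \<and> (\<forall>w. \<not> w \<^bold>\<in> z)) \<and>
          (\<forall>y. y \<^bold>\<in> x \<longrightarrow> (\<exists>z. z \<^bold>\<in> x \<and> (\<forall>w. w \<^bold>\<in> z \<longleftrightarrow> w \<^bold>\<in> y \<or> w = y)))"
    and separation: "\<exists>y. \<forall>z. z \<^bold>\<in> y \<longleftrightarrow> z \<^bold>\<in> x \<and> holds mem p (e(0 := z))"
    and replacement:
      "(\<And>z w w'. z \<^bold>\<in> x \<Longrightarrow> holds mem p (e(0 := z, 1 := w)) \<Longrightarrow> holds mem p (e(0 := z, 1 := w'))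
          \<Longrightarrow> w = w')
        \<Longrightarrow> \<exists>y. \<forall>w. w \<^bold>\<in> y \<longleftrightarrow> (\<exists>z. z \<^bold>\<in> x \<and> holds mem p (e(0 := z, 1 := w)))"
begin

text \<open>
  In everything below, quantifiers range over the elements of the universe only, so that all notions
  are those of ZF inside the universe. In particular functions, embeddings and the formulas
  with respect to which embeddings are elementary are elements of the universe.
\<close>

text \<open>Meaningful only when the class \<open>P\<close> is a set, which ZF proves in all uses below.\<close>
definition setof :: "('a \<Rightarrow> bool) \<Rightarrow> 'a" where
  "setof P = (THE x. \<forall>z. z \<^bold>\<in> x \<longleftrightarrow> P z)"

definition subset :: "'a \<Rightarrow> 'a \<Rightarrow> bool" where
  "subset x y \<longleftrightarrow> (\<forall>z. z \<^bold>\<in> x \<longrightarrow> z \<^bold>\<in> y)"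

definition transitive_set :: "'a \<Rightarrow> bool" where
  "transitive_set x \<longleftrightarrow> (\<forall>y. y \<^bold>\<in> x \<longrightarrow> subset y x)"

definition upair :: "'a \<Rightarrow> 'a \<Rightarrow> 'a" where
  "upair x y = setof (\<lambda>z. z = x \<or> z = y)"

definition opair :: "'a \<Rightarrow> 'a \<Rightarrow> 'a" where
  "opair x y = upair (upair x x) (upair x y)"

definition empty :: 'a where
  "empty = setof (\<lambda>_. False)"

definition succ :: "'a \<Rightarrow> 'a" where
  "succ x = setof (\<lambda>z. z \<^bold>\<in> x \<or> z = x)"

definition omega :: 'a where
  "omega = setof (\<lambda>n. \<forall>X. empty \<^bold>\<in> X \<and> (\<forall>k. k \<^bold>\<in> X \<longrightarrow> succ k \<^bold>\<in> X) \<longrightarrow> n \<^bold>\<in> X)"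


subsection \<open>Functions\<close>

definition is_fun :: "'a \<Rightarrow> 'a \<Rightarrow> 'a \<Rightarrow> bool" where
  "is_fun f A B \<longleftrightarrow>
     (\<forall>p. p \<^bold>\<in> f \<longrightarrow> (\<exists>x y. x \<^bold>\<in> A \<and> y \<^bold>\<in> B \<and> p = opair x y)) \<and>
     (\<forall>x. x \<^bold>\<in> A \<longrightarrow> (\<exists>!y. opair x y \<^bold>\<in> f))"

definition app :: "'a \<Rightarrow> 'a \<Rightarrow> 'a" where
  "app f x = (THE y. opair x y \<^bold>\<in> f)"

definition restrict :: "'a \<Rightarrow> 'a \<Rightarrow> 'a" where
  "restrict f A = setof (\<lambda>p. p \<^bold>\<in> f \<and> (\<exists>x y. x \<^bold>\<in> A \<and> p = opair x y))"

definition compose :: "'a \<Rightarrow> 'a \<Rightarrow> 'a" where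
  "compose g f = setof (\<lambda>p. \<exists>x y z. p = opair x z \<and> opair x y \<^bold>\<in> f \<and> opair y z \<^bold>\<in> g)"

definition update :: "'a \<Rightarrow> 'a \<Rightarrow> 'a \<Rightarrow> 'a" where
  "update f i x = setof (\<lambda>p. (p \<^bold>\<in> f \<and> \<not> (\<exists>y. p = opair i y)) \<or> p = opair i x)"

definition is_bij :: "'a \<Rightarrow> 'a \<Rightarrow> 'a \<Rightarrow> bool" where
  "is_bij f A B \<longleftrightarrow> is_fun f A B \<and> (\<forall>y. y \<^bold>\<in> B \<longrightarrow> (\<exists>!x. opair x y \<^bold>\<in> f))"


subsection \<open>Ordinals and cardinals\<close>

definition well_ordered_by_mem :: "'a \<Rightarrow> bool" where
  "well_ordered_by_mem A \<longleftrightarrow>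
     (\<forall>x. x \<^bold>\<in> A \<longrightarrow> \<not> x \<^bold>\<in> x) \<and>
     (\<forall>x y z. x \<^bold>\<in> A \<and> y \<^bold>\<in> A \<and> z \<^bold>\<in> A \<and> x \<^bold>\<in> y \<and> y \<^bold>\<in> z \<longrightarrow> x \<^bold>\<in> z) \<and>
     (\<forall>x y. x \<^bold>\<in> A \<and> y \<^bold>\<in> A \<longrightarrow> x \<^bold>\<in> y \<or> x = y \<or> y \<^bold>\<in> x) \<and>
     (\<forall>X. subset X A \<and> X \<noteq> empty \<longrightarrow>
        (\<exists>m. m \<^bold>\<in> X \<and> (\<forall>x. x \<^bold>\<in> X \<longrightarrow> m = x \<or> m \<^bold>\<in> x)))"

definition ordinal :: "'a \<Rightarrow> bool" where
  "ordinal x \<longleftrightarrow> transitive_set x \<and> well_ordered_by_mem x"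

text \<open>Initial ordinals; without Choice this is the notion of a (well-ordered) cardinal.\<close>
definition cardinal :: "'a \<Rightarrow> bool" where
  "cardinal k \<longleftrightarrow> ordinal k \<and> \<not> (\<exists>a f. a \<^bold>\<in> k \<and> is_bij f a k)"


subsection \<open>Satisfaction in a set structure and elementary embeddings\<close>

text \<open>
  The set \<open>Form\<close> of codes of first-order formulas of the language of set theory, with variables
  indexed by \<open>omega\<close>. It is the internal counterpart of the type \<^typ>\<open>fm\<close>; if \<open>omega\<close> of the
  universe is nonstandard, it also has nonstandard elements.
\<close>

primrec num :: "nat \<Rightarrow> 'a" where
  "num 0 = empty"
| "num (Suc n) = succ (num n)"

definition mem_code :: "'a \<Rightarrow> 'a \<Rightarrow> 'a" where
  "mem_code i j = opair (num 0) (opair i j)"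

definition eq_code :: "'a \<Rightarrow> 'a \<Rightarrow> 'a" where
  "eq_code i j = opair (num 1) (opair i j)"

definition neg_code :: "'a \<Rightarrow> 'a" where
  "neg_code p = opair (num 2) p"

definition conj_code :: "'a \<Rightarrow> 'a \<Rightarrow> 'a" where
  "conj_code p q = opair (num 3) (opair p q)"

definition ex_code :: "'a \<Rightarrow> 'a \<Rightarrow> 'a" where
  "ex_code i p = opair (num 4) (opair i p)"

definition formula_closed :: "'a \<Rightarrow> bool" where
  "formula_closed X \<longleftrightarrow>
     (\<forall>i j. i \<^bold>\<in> omega \<and> j \<^bold>\<in> omega \<longrightarrow> mem_code i j \<^bold>\<in> X \<and> eq_code i j \<^bold>\<in> X) \<and>
     (\<forall>p. p \<^bold>\<in> X \<longrightarrow> neg_code p \<^bold>\<in> X) \<and>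
     (\<forall>p q. p \<^bold>\<in> X \<and> q \<^bold>\<in> X \<longrightarrow> conj_code p q \<^bold>\<in> X) \<and>
     (\<forall>i p. i \<^bold>\<in> omega \<and> p \<^bold>\<in> X \<longrightarrow> ex_code i p \<^bold>\<in> X)"

definition Form :: 'a where
  "Form = setof (\<lambda>p. \<forall>X. formula_closed X \<longrightarrow> p \<^bold>\<in> X)"

text \<open>\<open>S\<close> is the satisfaction relation of \<open>\<langle>M, \<in>\<rangle>\<close>, given by Tarski's recursion.\<close>
definition satisfaction :: "'a \<Rightarrow> 'a \<Rightarrow> bool" where
  "satisfaction M S \<longleftrightarrow>
     (\<forall>r. r \<^bold>\<in> S \<longrightarrow> (\<exists>p s. r = opair p s \<and> p \<^bold>\<in> Form \<and> is_fun s omega M)) \<and>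
     (\<forall>s. is_fun s omega M \<longrightarrow>
        (\<forall>i j. i \<^bold>\<in> omega \<and> j \<^bold>\<in> omega \<longrightarrow>
           (opair (mem_code i j) s \<^bold>\<in> S \<longleftrightarrow> app s i \<^bold>\<in> app s j) \<and>
           (opair (eq_code i j) s \<^bold>\<in> S \<longleftrightarrow> app s i = app s j)) \<and>
        (\<forall>p. p \<^bold>\<in> Form \<longrightarrow> (opair (neg_code p) s \<^bold>\<in> S \<longleftrightarrow> \<not> opair p s \<^bold>\<in> S)) \<and>
        (\<forall>p q. p \<^bold>\<in> Form \<and> q \<^bold>\<in> Form \<longrightarrow>
           (opair (conj_code p q) s \<^bold>\<in> S \<longleftrightarrow> opair p s \<^bold>\<in> S \<and> opair q s \<^bold>\<in> S)) \<and>
        (\<forall>i p. i \<^bold>\<in> omega \<and> p \<^bold>\<in> Form \<longrightarrow>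
           (opair (ex_code i p) s \<^bold>\<in> S \<longleftrightarrow> (\<exists>x. x \<^bold>\<in> M \<and> opair p (update s i x) \<^bold>\<in> S))))"

definition models :: "'a \<Rightarrow> 'a \<Rightarrow> 'a \<Rightarrow> bool" where
  "models M p s \<longleftrightarrow> (\<exists>S. satisfaction M S \<and> opair p s \<^bold>\<in> S)"

definition elementary_embedding :: "'a \<Rightarrow> 'a \<Rightarrow> 'a \<Rightarrow> bool" where
  "elementary_embedding j M N \<longleftrightarrow> is_fun j M N \<and>
     (\<forall>p s. p \<^bold>\<in> Form \<and> is_fun s omega M \<longrightarrow> (models M p s \<longleftrightarrow> models N p (compose j s)))"


subsection \<open>Berkeley cardinals\<close>

definition nontrivial :: "'a \<Rightarrow> 'a \<Rightarrow> bool" where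
  "nontrivial j M \<longleftrightarrow> (\<exists>a. a \<^bold>\<in> M \<and> ordinal a \<and> app j a \<noteq> a)"

text \<open>\<open>k\<close> is the least ordinal of \<open>M\<close> moved by \<open>j\<close>.\<close>
definition is_crit :: "'a \<Rightarrow> 'a \<Rightarrow> 'a \<Rightarrow> bool" where
  "is_crit j M k \<longleftrightarrow> k \<^bold>\<in> M \<and> ordinal k \<and> app j k \<noteq> k \<and>
     (\<forall>a. a \<^bold>\<in> M \<and> ordinal a \<and> a \<^bold>\<in> k \<longrightarrow> app j a = a)"

definition berkeley :: "'a \<Rightarrow> bool" where
  "berkeley d \<longleftrightarrow> cardinal d \<and>
     (\<forall>M h. transitive_set M \<and> d \<^bold>\<in> M \<and> ordinal h \<and> h \<^bold>\<in> d \<longrightarrow>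
        (\<exists>j k. elementary_embedding j M M \<and> nontrivial j M \<and> is_crit j M k \<and> h \<^bold>\<in> k \<and> k \<^bold>\<in> d))"


subsection \<open>The potentialist system\<close>

definition world :: "'a \<Rightarrow> 'a \<Rightarrow> bool" where
  "world d M \<longleftrightarrow> transitive_set M \<and> d \<^bold>\<in> M"

definition accesses :: "'a \<Rightarrow> 'a \<Rightarrow> bool" where
  "accesses M N \<longleftrightarrow> subset M N \<and>
     (\<forall>j. elementary_embedding j N N \<longrightarrow> elementary_embedding (restrict j M) M M)"

definition set_structure :: "'a \<Rightarrow> 'a set \<times> ('a \<times> 'a) set" where
  "set_structure M = ({x. x \<^bold>\<in> M}, {(x, y). x \<^bold>\<in> M \<and> y \<^bold>\<in> M \<and> x \<^bold>\<in> y})"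

definition universe :: "'a set \<times> ('a \<times> 'a) set" where
  "universe = (UNIV, {(x, y). x \<^bold>\<in> y})"

end

definition substructure :: "'b set \<times> ('b \<times> 'b) set \<Rightarrow> 'b set \<times> ('b \<times> 'b) set \<Rightarrow> bool" where
  "substructure \<A> \<B> \<longleftrightarrow> fst \<A> \<noteq> {} \<and> fst \<A> \<subseteq> fst \<B> \<and> snd \<A> = snd \<B> \<inter> (fst \<A> \<times> fst \<A>)"

end

(*
  Let S be the satisfaction relation of M, let c = (M, S), and let T be a transitive set containing
  c, a and the set of formulas. Put N = T Un {T, {T, c}}. In N the pair {T, c} is the only element
  that belongs to no element, and c is the element of this pair that belongs to the other one; so an
  elementary embedding j of N into itself fixes c, hence M and S. Moreover j fixes omega and all
  formulas pointwise, so (p, s) in S implies (p, j o s) = j (p, s) in S for assignments s in M,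
  and the converse follows by negating p. Hence j restricted to M is elementary.
*)
theory Submission
  imports Defs
begin


section \<open>Definability with parameters\<close>

text \<open>Separation and Replacement are available for first-order formulas only, and the
  \<open>omega\<close> and \<open>Form\<close> of the universe may be nonstandard. Hence every
  comprehension, recursion and induction inside the universe must come with a formula for the class
  concerned; the \<open>definable\<close> calculus obtains that formula from the shape of the HOL
  term.

  The relation S is carried along as a set because elementarity is a statement about all elements of
  \<open>Form\<close>, nonstandard ones included, so it cannot be treated one HOL-level formula at a
  time. N is not asked to recognise S as a satisfaction relation: it is enough that j fixes it as a
  point. Only a few concrete formulas, with at most three free variables, are ever evaluated in N.

  A singleton {c} on top of T would not serve as a marker, since it may already be an element of T.
  The pair {T, c} is certainly new, because T \<in> {T, c} \<in> T would be a membership cycle; T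
  itself is added to keep N transitive.\<close>

primrec rename :: "(nat \<Rightarrow> nat) \<Rightarrow> fm \<Rightarrow> fm" where
  "rename f (Mem i j) = Mem (f i) (f j)"
| "rename f (Eq i j) = Eq (f i) (f j)"
| "rename f (Neg p) = Neg (rename f p)"
| "rename f (Conj p q) = Conj (rename f p) (rename f q)"
| "rename f (Ex i p) = Ex (f i) (rename f p)"

text \<open>Injectivity prevents capture: updating the renamed bound variable must not disturb the
  image of any other variable.\<close>

lemma holds_rename:
  assumes "inj f"
  shows "holds E (rename f p) e \<longleftrightarrow> holds E p (\<lambda>n. e (f n))"
proof (induction p arbitrary: e)
  case (Ex i p)
  have "(\<lambda>n. (e(f i := x)) (f n)) = (\<lambda>n. e (f n))(i := x)" for x
    using assms by (auto simp: fun_eq_iff inj_eq)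
  then show ?case using Ex by simp
qed auto

text \<open>Even slots hold the variables and odd slots the parameters, so there is always room for
  more of either kind.\<close>

definition interleave :: "(nat \<Rightarrow> 'a) \<Rightarrow> (nat \<Rightarrow> 'a) \<Rightarrow> nat \<Rightarrow> 'a" where
  "interleave c e n = (if even n then e (n div 2) else c (n div 2))"

lemma interleave_update: "(interleave c e)(2 * i := x) = interleave c (e(i := x))"
proof
  fix n
  show "((interleave c e)(2 * i := x)) n = interleave c (e(i := x)) n"
    by (cases "n = 2 * i") (auto simp: interleave_def)
qed

text \<open>The parameter sequence \<open>c\<close> is chosen once for all \<open>e\<close>.
  Although it is a HOL function, a formula reads only finitely many of its entries, so this is
  ordinary definability with parameters.\<close>

definition definable :: "((nat \<Rightarrow> 'v::zf) \<Rightarrow> bool) \<Rightarrow> bool" where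
  "definable P \<longleftrightarrow> (\<exists>p c. \<forall>e. P e \<longleftrightarrow> holds mem p (interleave c e))"

definition definable_term :: "((nat \<Rightarrow> 'v::zf) \<Rightarrow> 'v) \<Rightarrow> bool" where
  "definable_term t \<longleftrightarrow> definable (\<lambda>e. e 0 = t (\<lambda>n. e (Suc n)))"

lemma definable_rename:
  assumes "definable P" "inj f"
  shows "definable (\<lambda>e. P (\<lambda>n. e (f n)))"
proof -
  obtain p c where p: "\<And>e. P e \<longleftrightarrow> holds mem p (interleave c e)"
    using assms(1) unfolding definable_def by auto
  \<comment> \<open>Renames the variable slots by \<open>f\<close> and leaves the parameter slots
    alone.\<close>
  let ?g = "\<lambda>n. if even n then 2 * f (n div 2) else n"
  have "inj ?g"
  proof (rule injI)
    fix m n assume *: "?g m = ?g n"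
    then have "even m \<longleftrightarrow> even n"
      by (metis dvd_triv_left)
    moreover from * this have "even m \<Longrightarrow> m div 2 = n div 2"
      using injD[OF assms(2), of "m div 2" "n div 2"] by simp
    ultimately show "m = n"
      using * by (metis dvd_mult_div_cancel)
  qed
  moreover have "(\<lambda>n. interleave c e (?g n)) = interleave c (\<lambda>n. e (f n))" for e
    by (auto simp: interleave_def fun_eq_iff)
  ultimately have "P (\<lambda>n. e (f n)) \<longleftrightarrow> holds mem (rename ?g p) (interleave c e)" for e
    by (simp add: holds_rename p)
  then show ?thesis unfolding definable_def by blast
qed

lemma definable_not:
  assumes "definable P"
  shows "definable (\<lambda>e. \<not> P e)"
proof -
  obtain p c where "\<And>e. P e \<longleftrightarrow> holds mem p (interleave c e)"
    using assms unfolding definable_def by auto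
  then have "\<forall>e. (\<not> P e) \<longleftrightarrow> holds mem (Neg p) (interleave c e)" by simp
  then show ?thesis unfolding definable_def by blast
qed

lemma definable_conj:
  assumes "definable P" "definable Q"
  shows "definable (\<lambda>e. P e \<and> Q e)"
proof -
  obtain p c q d where p: "\<And>e. P e \<longleftrightarrow> holds mem p (interleave c e)"
    and q: "\<And>e. Q e \<longleftrightarrow> holds mem q (interleave d e)"
    using assms unfolding definable_def by auto
  \<comment> \<open>The two parameter sequences are merged: parameter k of \<open>p\<close> moves to
    parameter 2k, slot 4k + 1, and parameter k of \<open>q\<close> to parameter 2k + 1, slot 4k + 3.
    The variables are shared.\<close>
  let ?f = "\<lambda>n::nat. if even n then n else 2 * n - 1"
  let ?g = "\<lambda>n::nat. if even n then n else 2 * n + 1"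
  have f: "inj ?f" and g: "inj ?g"
    by (rule inj_on_inverseI[where g = "\<lambda>n. if even n then n else (n + 1) div 2"], auto)
      (rule inj_on_inverseI[where g = "\<lambda>n. if even n then n else n div 2"], auto)
  have "(\<lambda>n. interleave (interleave d c) e (?f n)) = interleave c e" for e
  proof
    fix n
    show "interleave (interleave d c) e (?f n) = interleave c e n"
    proof (cases "even n")
      case False
      then obtain k where "n = 2 * k + 1" by (auto elim: oddE)
      then show ?thesis by (simp add: interleave_def)
    qed (simp add: interleave_def)
  qed
  moreover have "(\<lambda>n. interleave (interleave d c) e (?g n)) = interleave d e" for e
  proof
    fix n
    show "interleave (interleave d c) e (?g n) = interleave d e n"
    proof (cases "even n")
      case False
      then obtain k where "n = 2 * k + 1" by (auto elim: oddE)
      then show ?thesis by (simp add: interleave_def)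
    qed (simp add: interleave_def)
  qed
  ultimately have "\<forall>e. P e \<and> Q e \<longleftrightarrow>
      holds mem (Conj (rename ?f p) (rename ?g q)) (interleave (interleave d c) e)"
    unfolding holds.simps holds_rename[OF f] holds_rename[OF g] by (simp add: p q)
  then show ?thesis unfolding definable_def by blast
qed

text \<open>
  Quantifiers shift the environment by one, as with de Bruijn indices. The bound variable is
  stored in a fresh parameter slot, so that renaming along injections suffices.
\<close>

lemma definable_ex:
  assumes "definable (\<lambda>e. P (e 0) (\<lambda>n. e (Suc n)))"
  shows "definable (\<lambda>e. \<exists>x. P x e)"
proof -
  obtain p c where p: "\<And>e. P (e 0) (\<lambda>n. e (Suc n)) \<longleftrightarrow> holds mem p (interleave c e)"
    using assms unfolding definable_def by auto
  let ?f = "\<lambda>n::nat. if n = 0 then 1 else if even n then n - 2 else n + 2"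
  let ?g = "\<lambda>n::nat. if n = 1 then 0 else if even n then n + 2 else n - 2"
  have f: "inj ?f"
    by (rule inj_on_inverseI[where g = ?g]) (auto, presburger)
  \<comment> \<open>The new entry occupies slot 1, which the quantifier overwrites, so
    \<open>undefined\<close> is never read.\<close>
  let ?c = "case_nat undefined c"
  have "(\<lambda>n. ((interleave ?c e)(1 := x)) (?f n)) = interleave c (case_nat x e)" for e x
  proof
    fix n
    show "((interleave ?c e)(1 := x)) (?f n) = interleave c (case_nat x e) n"
    proof (cases "even n")
      case True
      then obtain k where "n = 2 * k" by (auto elim: evenE)
      then show ?thesis by (cases k) (auto simp: interleave_def)
    next
      case False
      then obtain k where "n = 2 * k + 1" by (auto elim: oddE)
      then show ?thesis by (auto simp: interleave_def)
    qed
  qed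
  then have "holds mem (Ex 1 (rename ?f p)) (interleave ?c e) \<longleftrightarrow> (\<exists>x. P x e)" for e
    unfolding holds.simps holds_rename[OF f] by (simp add: p[symmetric])
  then have "\<forall>e. (\<exists>x. P x e) \<longleftrightarrow> holds mem (Ex 1 (rename ?f p)) (interleave ?c e)" by simp
  then show ?thesis unfolding definable_def by blast
qed

lemma definable_atoms:
  shows definable_mem_vars: "definable (\<lambda>e. e i \<^bold>\<in> e j)"
    and definable_eq_vars: "definable (\<lambda>e. e i = e j)"
proof -
  have "\<forall>e. e i \<^bold>\<in> e j \<longleftrightarrow> holds mem (Mem (2 * i) (2 * j)) (interleave undefined e)"
    and "\<forall>e. e i = e j \<longleftrightarrow> holds mem (Eq (2 * i) (2 * j)) (interleave undefined e)"
    by (simp_all add: interleave_def)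
  then show "definable (\<lambda>e. e i \<^bold>\<in> e j)" "definable (\<lambda>e. e i = e j)"
    unfolding definable_def by blast+
qed

lemma definable_eq_const: "definable (\<lambda>e. e i = c)"
proof -
  have "\<forall>e. e i = c \<longleftrightarrow> holds mem (Eq (2 * i) 1) (interleave (\<lambda>_. c) e)"
    by (simp add: interleave_def)
  then show ?thesis unfolding definable_def by blast
qed

lemma definable_term_var: "definable_term (\<lambda>e. e i)"
  unfolding definable_term_def by (rule definable_eq_vars)

lemma definable_term_const: "definable_term (\<lambda>e. c)"
  unfolding definable_term_def by (rule definable_eq_const)

text \<open>Weakening: lets a term pass under a binder, which takes over index 0.\<close>

lemma definable_term_shift:
  assumes "definable_term t"
  shows "definable_term (\<lambda>e. t (\<lambda>n. e (Suc n)))"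
proof -
  have "inj (\<lambda>n::nat. if n = 0 then 0 else Suc n)"
    by (rule injI) (auto split: if_splits)
  from definable_rename[OF assms[unfolded definable_term_def] this]
  show ?thesis unfolding definable_term_def by simp
qed

text \<open>The language has no function symbols, so a term is eliminated through an existentially
  quantified value.\<close>

lemma definable_subst:
  assumes "definable (\<lambda>e. P (e 0) (\<lambda>n. e (Suc n)))" "definable_term t"
  shows "definable (\<lambda>e. P (t e) e)"
proof -
  have "definable (\<lambda>e. \<exists>x. x = t e \<and> P x e)"
    by (intro definable_ex definable_conj assms(1) assms(2)[unfolded definable_term_def])
  then show ?thesis by simp
qed

lemma definable_mem: "definable (\<lambda>e. s e \<^bold>\<in> t e)" if "definable_term s" "definable_term t"
proof (rule definable_subst[OF _ that(1)])
  show "definable (\<lambda>e. e 0 \<^bold>\<in> t (\<lambda>n. e (Suc n)))"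
    by (rule definable_subst[OF _ definable_term_shift[OF that(2)]]) (rule definable_mem_vars)
qed

lemma definable_eq: "definable (\<lambda>e. s e = t e)" if "definable_term s" "definable_term t"
  by (rule definable_subst[OF _ that(1)]) (rule that(2)[unfolded definable_term_def])

lemma definable_disj:
  assumes "definable P" "definable Q"
  shows "definable (\<lambda>e. P e \<or> Q e)"
proof -
  have "definable (\<lambda>e. \<not> (\<not> P e \<and> \<not> Q e))"
    by (intro definable_not definable_conj assms)
  then show ?thesis by simp
qed

lemma definable_imp:
  assumes "definable P" "definable Q"
  shows "definable (\<lambda>e. P e \<longrightarrow> Q e)"
  unfolding imp_conv_disj by (intro definable_not definable_disj assms)

lemma definable_iff:
  assumes "definable P" "definable Q"
  shows "definable (\<lambda>e. P e \<longleftrightarrow> Q e)"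
  unfolding iff_conv_conj_imp by (intro definable_imp definable_conj assms)

lemma definable_all:
  assumes "definable (\<lambda>e. P (e 0) (\<lambda>n. e (Suc n)))"
  shows "definable (\<lambda>e. \<forall>x. P x e)"
proof -
  have "definable (\<lambda>e. \<not> (\<exists>x. \<not> P x e))"
    by (intro definable_not definable_ex assms)
  then show ?thesis by simp
qed

lemma definable_term_app:
  assumes "definable_term (\<lambda>e. G (e 0))" "definable_term t"
  shows "definable_term (\<lambda>e. G (t e))"
  unfolding definable_term_def
proof (rule definable_subst[OF _ definable_term_shift[OF assms(2)]])
  \<comment> \<open>The hypothesis has the value at index 0 and the argument at index 1;
    substitution for the argument wants them swapped.\<close>
  let ?f = "\<lambda>n::nat. if n = 0 then 1 else if n = 1 then 0 else n"
  have "inj ?f"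
    by (rule inj_on_inverseI[where g = ?f]) auto
  from definable_rename[OF assms(1)[unfolded definable_term_def] this]
  show "definable (\<lambda>e. e (Suc 0) = G (e 0))" by simp
qed

lemmas definable_logic = definable_ex definable_all definable_conj definable_disj definable_imp
  definable_iff definable_not definable_mem definable_eq definable_term_var definable_term_const


section \<open>Basic set theory\<close>

lemma setof_iff:
  fixes P :: "'v::zf \<Rightarrow> bool"
  assumes "\<exists>x. \<forall>z. z \<^bold>\<in> x \<longleftrightarrow> P z"
  shows "z \<^bold>\<in> setof P \<longleftrightarrow> P z"
proof -
  have "\<exists>!x. \<forall>z. z \<^bold>\<in> x \<longleftrightarrow> P z"
    using assms by (auto intro: extensionality)
  from theI'[OF this] show ?thesis unfolding setof_def by blast
qed

text \<open>Where the class is a set, being equal to it is the first-order condition of having the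
  right elements. Existence is demanded for every \<open>e\<close> because otherwise the description
  operator would return an unspecified value.\<close>

lemma definable_term_setof:
  fixes P :: "'v::zf \<Rightarrow> (nat \<Rightarrow> 'v) \<Rightarrow> bool"
  assumes "\<And>e. \<exists>x. \<forall>z. z \<^bold>\<in> x \<longleftrightarrow> P z e"
    and "definable (\<lambda>e. P (e 0) (\<lambda>n. e (Suc n)))"
  shows "definable_term (\<lambda>e. setof (\<lambda>z. P z e))"
proof -
  have eq: "y = setof (\<lambda>z. P z e) \<longleftrightarrow> (\<forall>z. z \<^bold>\<in> y \<longleftrightarrow> P z e)" for y e
  proof
    assume "\<forall>z. z \<^bold>\<in> y \<longleftrightarrow> P z e"
    then show "y = setof (\<lambda>z. P z e)"
      by (intro extensionality) (simp add: setof_iff[OF assms(1)])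
  qed (simp add: setof_iff[OF assms(1)])
  let ?f = "\<lambda>n::nat. if n = 0 then 0 else Suc n"
  have "inj ?f" by (rule injI) (auto split: if_splits)
  from definable_rename[OF assms(2) this]
  have "definable (\<lambda>e. P (e 0) (\<lambda>n. e (Suc (Suc n))))" by simp
  then show ?thesis unfolding definable_term_def eq
    by (intro definable_all definable_iff definable_mem_vars)
qed

lemma comprehension:
  fixes P :: "'v::zf \<Rightarrow> bool"
  assumes "definable (\<lambda>e. P (e 0))" "\<And>z. P z \<Longrightarrow> z \<^bold>\<in> x"
  shows "\<exists>y. \<forall>z. z \<^bold>\<in> y \<longleftrightarrow> P z"
proof -
  obtain p c where p: "\<And>e. P (e 0) \<longleftrightarrow> holds mem p (interleave c e)"
    using assms(1) unfolding definable_def by auto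
  obtain y where "\<And>z. z \<^bold>\<in> y \<longleftrightarrow> z \<^bold>\<in> x \<and> holds mem p ((interleave c undefined)(0 := z))"
    using separation[of x p "interleave c undefined"] by blast
  moreover have "(interleave c undefined)(0 := z) = interleave c (undefined(0 := z))" for z
    using interleave_update[of c undefined 0] by simp
  ultimately have "z \<^bold>\<in> y \<longleftrightarrow> P z" for z
    using p[of "undefined(0 := z)"] assms(2) by auto
  then show ?thesis by blast
qed

lemma replacement_definable:
  fixes R :: "'v::zf \<Rightarrow> 'v \<Rightarrow> bool"
  assumes "definable (\<lambda>e. R (e 0) (e 1))"
    and "\<And>z w w'. z \<^bold>\<in> x \<Longrightarrow> R z w \<Longrightarrow> R z w' \<Longrightarrow> w = w'"
  shows "\<exists>y. \<forall>w. w \<^bold>\<in> y \<longleftrightarrow> (\<exists>z. z \<^bold>\<in> x \<and> R z w)"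
proof -
  obtain p c where p: "\<And>e. R (e 0) (e 1) \<longleftrightarrow> holds mem p (interleave c e)"
    using assms(1) unfolding definable_def by auto
  \<comment> \<open>The axiom puts its two arguments in slots 0 and 1, while variables 0 and 1 of an
    interleaved environment sit in slots 0 and 2.\<close>
  let ?f = "\<lambda>n::nat. if n = 1 then 2 else if n = 2 then 1 else n"
  have f: "inj ?f" by (rule inj_on_inverseI[where g = ?f]) auto
  let ?e = "(\<lambda>n. interleave c undefined (?f n))"
  have R: "holds mem (rename ?f p) (?e(0 := z, 1 := w)) \<longleftrightarrow> R z w" for z w
  proof -
    have "interleave c (undefined(0 := z, 1 := w)) = (interleave c undefined)(0 := z, 2 := w)"
      by (simp flip: interleave_update[of c _ 0, simplified] interleave_update[of c _ 1, simplified])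
    also have "\<dots> = (\<lambda>n. (?e(0 := z, 1 := w)) (?f n))"
      by (rule ext) simp
    finally show ?thesis
      using p[of "undefined(0 := z, 1 := w)"] by (simp only: holds_rename[OF f]) simp
  qed
  show ?thesis
    using replacement[of x "rename ?f p" ?e] assms(2) unfolding R by blast
qed

section \<open>Pairs, unions, power sets and successors, with their definability\<close>

lemma mem_upair [simp]: "z \<^bold>\<in> upair x y \<longleftrightarrow> z = x \<or> z = y"
  unfolding upair_def by (rule setof_iff[OF pairing])

lemma definable_upair:
  assumes "definable_term s" "definable_term t"
  shows "definable_term (\<lambda>e. upair (s e) (t e))"
  unfolding upair_def
  by (rule definable_term_setof[OF pairing])
    (intro definable_logic definable_term_shift assms)

lemma upair_inject: "upair x y = upair x' y' \<longleftrightarrow> x = x' \<and> y = y' \<or> x = y' \<and> y = x'"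
proof
  assume "upair x y = upair x' y'"
  then have "z = x \<or> z = y \<longleftrightarrow> z = x' \<or> z = y'" for z
    using mem_upair by metis
  then show "x = x' \<and> y = y' \<or> x = y' \<and> y = x'" by metis
qed (auto intro: extensionality)

lemma opair_inject [simp]: "opair x y = opair x' y' \<longleftrightarrow> x = x' \<and> y = y'"
  unfolding opair_def by (auto simp: upair_inject)

lemma definable_opair:
  "definable_term s \<Longrightarrow> definable_term t \<Longrightarrow> definable_term (\<lambda>e. opair (s e) (t e))"
  unfolding opair_def by (intro definable_upair)

text \<open>Foundation applied to the pair of \<open>x\<close> and \<open>y\<close>, each element of
  which would contain the other.\<close>

lemma not_mem_cycle: "x \<^bold>\<in> y \<Longrightarrow> \<not> y \<^bold>\<in> x"
  using foundation[of x "upair x y"] by auto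

lemma not_mem_self: "\<not> x \<^bold>\<in> x"
  using not_mem_cycle by blast

lemma mem_empty [simp]: "\<not> z \<^bold>\<in> empty"
proof -
  have "\<exists>y. \<forall>z::'a. z \<^bold>\<in> y \<longleftrightarrow> False"
    \<comment> \<open>Any set will do here: an unsatisfiable formula separates the empty set from
      it.\<close>
    using separation[of undefined "Neg (Eq 0 0)" undefined] by simp
  from setof_iff[OF this] show ?thesis unfolding empty_def by simp
qed

definition bigcup :: "'v::zf \<Rightarrow> 'v" where
  "bigcup x = setof (\<lambda>z. \<exists>y. y \<^bold>\<in> x \<and> z \<^bold>\<in> y)"

definition cup :: "'v::zf \<Rightarrow> 'v \<Rightarrow> 'v" where
  "cup x y = bigcup (upair x y)"

definition pow :: "'v::zf \<Rightarrow> 'v" where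
  "pow x = setof (\<lambda>z. subset z x)"

lemma mem_bigcup: "z \<^bold>\<in> bigcup x \<longleftrightarrow> (\<exists>y. y \<^bold>\<in> x \<and> z \<^bold>\<in> y)"
  unfolding bigcup_def by (rule setof_iff[OF union])

lemma mem_cup [simp]: "z \<^bold>\<in> cup x y \<longleftrightarrow> z \<^bold>\<in> x \<or> z \<^bold>\<in> y"
  unfolding cup_def by (auto simp: mem_bigcup)

lemma mem_pow [simp]: "z \<^bold>\<in> pow x \<longleftrightarrow> subset z x"
  unfolding pow_def by (rule setof_iff) (use power_set[of x] in \<open>simp add: subset_def\<close>)

lemma definable_bigcup: "definable_term t \<Longrightarrow> definable_term (\<lambda>e. bigcup (t e))"
  unfolding bigcup_def
  by (rule definable_term_setof[OF union])
    (intro definable_logic definable_term_shift)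

lemma definable_cup:
  "definable_term s \<Longrightarrow> definable_term t \<Longrightarrow> definable_term (\<lambda>e. cup (s e) (t e))"
  unfolding cup_def by (intro definable_bigcup definable_upair)

lemma definable_subset:
  assumes "definable_term s" "definable_term t"
  shows "definable (\<lambda>e. subset (s e) (t e))"
  unfolding subset_def
  by (intro definable_logic definable_term_shift assms)

lemma definable_pow:
  assumes "definable_term t"
  shows "definable_term (\<lambda>e. pow (t e))"
  unfolding pow_def
  by (rule definable_term_setof, metis mem_pow)
    (intro definable_subset definable_term_var definable_term_shift assms)

lemma succ_exists: "\<exists>y. \<forall>z. z \<^bold>\<in> y \<longleftrightarrow> z \<^bold>\<in> x \<or> z = x"
  by (rule exI[of _ "cup x (upair x x)"]) auto

lemma mem_succ [simp]: "z \<^bold>\<in> succ x \<longleftrightarrow> z \<^bold>\<in> x \<or> z = x"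
  unfolding succ_def by (rule setof_iff[OF succ_exists])

lemma definable_succ:
  assumes "definable_term t"
  shows "definable_term (\<lambda>e. succ (t e))"
  unfolding succ_def
  by (rule definable_term_setof[OF succ_exists])
    (intro definable_logic definable_term_shift assms)

lemma succ_inject [simp]: "succ x = succ y \<longleftrightarrow> x = y"
  by (metis mem_succ not_mem_cycle)

lemma succ_neq_empty [simp]: "succ x \<noteq> empty" "empty \<noteq> succ x"
  by (metis mem_empty mem_succ)+

lemmas definability = definable_logic definable_opair definable_upair definable_cup
  definable_bigcup definable_pow definable_succ definable_subset

section \<open>Natural numbers of the universe\<close>

lemma mem_omega:
  "n \<^bold>\<in> omega \<longleftrightarrow> (\<forall>X. empty \<^bold>\<in> X \<and> (\<forall>k. k \<^bold>\<in> X \<longrightarrow> succ k \<^bold>\<in> X) \<longrightarrow> n \<^bold>\<in> X)"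
  for n :: "'v::zf"
proof -
  obtain X :: 'v where X: "\<exists>z. z \<^bold>\<in> X \<and> (\<forall>w. \<not> w \<^bold>\<in> z)"
    "\<And>y. y \<^bold>\<in> X \<Longrightarrow> \<exists>z. z \<^bold>\<in> X \<and> (\<forall>w. w \<^bold>\<in> z \<longleftrightarrow> w \<^bold>\<in> y \<or> w = y)"
    using infinity by blast
  have "empty \<^bold>\<in> X"
    using X(1) by (metis extensionality mem_empty)
  moreover have "succ y \<^bold>\<in> X" if "y \<^bold>\<in> X" for y
    using X(2)[OF that] by (metis extensionality mem_succ)
  ultimately show ?thesis
    unfolding omega_def
    by (intro setof_iff comprehension[where x = X]) (intro definability, blast)
qed

lemma empty_omega [simp]: "empty \<^bold>\<in> omega"
  by (simp add: mem_omega)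

lemma succ_omega [simp]: "k \<^bold>\<in> omega \<Longrightarrow> succ k \<^bold>\<in> omega"
  by (auto simp: mem_omega)

lemma num_omega [simp]: "num n \<^bold>\<in> omega"
  by (induction n) auto

lemma num_inject [simp]: "num m = num n \<longleftrightarrow> m = n"
proof (induction m arbitrary: n)
  case 0 then show ?case by (cases n) auto
next
  case (Suc m) then show ?case by (cases n) auto
qed

declare num.simps [simp del]

text \<open>Minimality of \<open>omega\<close> applied to the subset of those k that satisfy
  \<open>P\<close>. Definability makes this subset exist; arbitrary HOL predicates would fail for
  nonstandard \<open>omega\<close>.\<close>

lemma omega_induct [consumes 1, case_names definable empty succ]:
  assumes "n \<^bold>\<in> omega" "definable (\<lambda>e. P (e 0))" "P empty"
    and "\<And>k. k \<^bold>\<in> omega \<Longrightarrow> P k \<Longrightarrow> P (succ k)"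
  shows "P n"
proof -
  obtain X where X: "\<And>k. k \<^bold>\<in> X \<longleftrightarrow> k \<^bold>\<in> omega \<and> P k"
    using comprehension[of "\<lambda>k. k \<^bold>\<in> omega \<and> P k" omega] assms(2)
      definable_conj[OF definable_mem[OF definable_term_var definable_term_const]] by blast
  have "empty \<^bold>\<in> X \<and> (\<forall>k. k \<^bold>\<in> X \<longrightarrow> succ k \<^bold>\<in> X)"
    using assms(3,4) by (simp add: X)
  then have "n \<^bold>\<in> X"
    using assms(1) mem_omega by blast
  then show ?thesis using X by simp
qed

subsection \<open>Functions\<close>

definition product :: "'v::zf \<Rightarrow> 'v \<Rightarrow> 'v" where
  "product A B = setof (\<lambda>p. \<exists>x y. x \<^bold>\<in> A \<and> y \<^bold>\<in> B \<and> p = opair x y)"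

lemma mem_product: "p \<^bold>\<in> product A B \<longleftrightarrow> (\<exists>x y. x \<^bold>\<in> A \<and> y \<^bold>\<in> B \<and> p = opair x y)"
  unfolding product_def
\<comment> \<open>A Kuratowski pair is a set of subsets of the union of \<open>A\<close> and
  \<open>B\<close>, whence the double power set as a bound.\<close>
proof (intro setof_iff comprehension[where x = "pow (pow (cup A B))"])
  show "definable (\<lambda>e. \<exists>x y. x \<^bold>\<in> A \<and> y \<^bold>\<in> B \<and> e 0 = opair x y)"
    by (intro definability)
qed (auto simp: subset_def opair_def)

lemma is_fun_app:
  assumes "is_fun f A B" "x \<^bold>\<in> A"
  shows opair_mem_fun_iff: "opair x y \<^bold>\<in> f \<longleftrightarrow> app f x = y" and app_mem: "app f x \<^bold>\<in> B"
proof -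
  have ex1: "\<exists>!y. opair x y \<^bold>\<in> f" using assms unfolding is_fun_def by blast
  from theI'[OF this] have mem: "opair x (app f x) \<^bold>\<in> f" unfolding app_def .
  with ex1 show "opair x y \<^bold>\<in> f \<longleftrightarrow> app f x = y" by blast
  show "app f x \<^bold>\<in> B" using mem assms(1) unfolding is_fun_def by fastforce
qed

lemma mem_fun_iff:
  assumes "is_fun f A B"
  shows "p \<^bold>\<in> f \<longleftrightarrow> (\<exists>x. x \<^bold>\<in> A \<and> p = opair x (app f x))"
  using assms opair_mem_fun_iff[OF assms] unfolding is_fun_def by metis

lemma fun_eqI:
  assumes "is_fun f A B" "is_fun g A C" "\<And>x. x \<^bold>\<in> A \<Longrightarrow> app f x = app g x"
  shows "f = g"
  using assms(3)
  by (intro extensionality) (auto simp: mem_fun_iff[OF assms(1)] mem_fun_iff[OF assms(2)])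

lemma is_funI:
  assumes "\<And>p. p \<^bold>\<in> f \<longleftrightarrow> (\<exists>x. x \<^bold>\<in> A \<and> p = opair x (h x))" "\<And>x. x \<^bold>\<in> A \<Longrightarrow> h x \<^bold>\<in> B"
  shows "is_fun f A B" and "\<And>x. x \<^bold>\<in> A \<Longrightarrow> app f x = h x"
proof -
  show *: "is_fun f A B" unfolding is_fun_def using assms by auto
  show "app f x = h x" if "x \<^bold>\<in> A" for x
    using opair_mem_fun_iff[OF * that] assms that by auto
qed

lemma definable_is_fun: "definable (\<lambda>e. is_fun (e i) A B)"
  unfolding is_fun_def Ex1_def by (intro definability)

definition maps :: "'v::zf \<Rightarrow> 'v \<Rightarrow> 'v" where
  "maps A B = setof (\<lambda>f. is_fun f A B)"

lemma mem_maps [simp]: "f \<^bold>\<in> maps A B \<longleftrightarrow> is_fun f A B"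
  unfolding maps_def
proof (intro setof_iff comprehension[where x = "pow (product A B)"] definable_is_fun)
  show "is_fun z A B \<Longrightarrow> z \<^bold>\<in> pow (product A B)" for z
    by (auto simp: subset_def mem_product is_fun_def)
qed

lemma update_exists:
  "\<exists>y. \<forall>p. p \<^bold>\<in> y \<longleftrightarrow> (p \<^bold>\<in> f \<and> \<not> (\<exists>y. p = opair i y)) \<or> p = opair i x"
  by (intro comprehension[where x = "cup f (upair (opair i x) (opair i x))"])
    (intro definability, auto)

lemma mem_update: "p \<^bold>\<in> update f i x \<longleftrightarrow> (p \<^bold>\<in> f \<and> \<not> (\<exists>y. p = opair i y)) \<or> p = opair i x"
  unfolding update_def by (rule setof_iff[OF update_exists])

lemma definable_update:
  assumes "definable_term f" "definable_term i" "definable_term x"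
  shows "definable_term (\<lambda>e. update (f e) (i e) (x e))"
  unfolding update_def
  by (rule definable_term_setof[OF update_exists])
    (intro definability definable_term_shift assms definable_term_shift[OF definable_term_shift[OF assms(2)]])

lemma
  assumes "is_fun f A B" "i \<^bold>\<in> A" "x \<^bold>\<in> B"
  shows is_fun_update: "is_fun (update f i x) A B"
    and app_update: "j \<^bold>\<in> A \<Longrightarrow> app (update f i x) j = (if j = i then x else app f j)"
proof -
  have *: "p \<^bold>\<in> update f i x \<longleftrightarrow> (\<exists>j. j \<^bold>\<in> A \<and> p = opair j (if j = i then x else app f j))" for p
    unfolding mem_update using assms(2) by (auto simp: mem_fun_iff[OF assms(1)])
  have "(if j = i then x else app f j) \<^bold>\<in> B" if "j \<^bold>\<in> A" for j
    using assms that by (simp add: app_mem)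
  from is_funI[OF * this]
  show "is_fun (update f i x) A B"
    and "j \<^bold>\<in> A \<Longrightarrow> app (update f i x) j = (if j = i then x else app f j)" by auto
qed

lemma
  assumes "is_fun f A B" "is_fun g B C"
  shows is_fun_compose: "is_fun (compose g f) A C"
    and app_compose: "i \<^bold>\<in> A \<Longrightarrow> app (compose g f) i = app g (app f i)"
proof -
  have "\<exists>q. \<forall>p. p \<^bold>\<in> q \<longleftrightarrow> (\<exists>x y z. p = opair x z \<and> opair x y \<^bold>\<in> f \<and> opair y z \<^bold>\<in> g)"
  proof (rule comprehension[where x = "product A C"])
    show "definable (\<lambda>e. \<exists>x y z. e 0 = opair x z \<and> opair x y \<^bold>\<in> f \<and> opair y z \<^bold>\<in> g)"
      by (intro definability)
  next
    fix p assume "\<exists>x y z. p = opair x z \<and> opair x y \<^bold>\<in> f \<and> opair y z \<^bold>\<in> g"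
    then show "p \<^bold>\<in> product A C"
      using assms unfolding mem_product is_fun_def by fastforce
  qed
  from setof_iff[OF this]
  have "p \<^bold>\<in> compose g f \<longleftrightarrow> (\<exists>x y z. p = opair x z \<and> opair x y \<^bold>\<in> f \<and> opair y z \<^bold>\<in> g)" for p
    unfolding compose_def .
  also have "\<dots> p \<longleftrightarrow> (\<exists>i. i \<^bold>\<in> A \<and> p = opair i (app g (app f i)))" for p
    using app_mem[OF assms(1)] by (auto simp: mem_fun_iff[OF assms(1)] mem_fun_iff[OF assms(2)])
  finally have *: "p \<^bold>\<in> compose g f \<longleftrightarrow> (\<exists>i. i \<^bold>\<in> A \<and> p = opair i (app g (app f i)))" for p .
  have "app g (app f i) \<^bold>\<in> C" if "i \<^bold>\<in> A" for i
    using assms that by (simp add: app_mem)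
  from is_funI[OF * this]
  show "is_fun (compose g f) A C" and "i \<^bold>\<in> A \<Longrightarrow> app (compose g f) i = app g (app f i)"
    by auto
qed

lemma
  assumes "is_fun f A B" "subset C A" "\<And>x. x \<^bold>\<in> C \<Longrightarrow> app f x \<^bold>\<in> D"
  shows is_fun_restrict: "is_fun (restrict f C) C D"
    and app_restrict: "x \<^bold>\<in> C \<Longrightarrow> app (restrict f C) x = app f x"
proof -
  have "\<exists>q. \<forall>p. p \<^bold>\<in> q \<longleftrightarrow> p \<^bold>\<in> f \<and> (\<exists>x y. x \<^bold>\<in> C \<and> p = opair x y)"
    by (rule comprehension[where x = f]) (intro definability, blast)
  from setof_iff[OF this]
  have *: "p \<^bold>\<in> restrict f C \<longleftrightarrow> (\<exists>x. x \<^bold>\<in> C \<and> p = opair x (app f x))" for p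
    using assms(2) unfolding restrict_def subset_def by (auto simp: mem_fun_iff[OF assms(1)])
  from is_funI[OF * assms(3)]
  show "is_fun (restrict f C) C D" and "x \<^bold>\<in> C \<Longrightarrow> app (restrict f C) x = app f x"
    by auto
qed

subsection \<open>Iteration along \<open>omega\<close>\<close>

text \<open>
  The iterates of \<open>G\<close> are read off from grounded sets \<open>f\<close> of pairs: every \<open>(k, u)\<close> in \<open>f\<close>
  is \<open>(0, x)\<close> or arises from a predecessor in \<open>f\<close>. These determine \<open>u\<close> from \<open>k\<close>.
\<close>

lemma iterates_exist:
  fixes x :: "'v::zf"
  assumes G: "definable_term (\<lambda>e. G (e 0))"
  obtains Y where "x \<^bold>\<in> Y" "\<And>u. u \<^bold>\<in> Y \<Longrightarrow> G u \<^bold>\<in> Y"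
    "\<And>P u. definable (\<lambda>e. P (e 0)) \<Longrightarrow> P x \<Longrightarrow> (\<And>u. u \<^bold>\<in> Y \<Longrightarrow> P u \<Longrightarrow> P (G u)) \<Longrightarrow> u \<^bold>\<in> Y \<Longrightarrow> P u"
proof -
  define R where "R k u \<longleftrightarrow> (\<exists>f. opair k u \<^bold>\<in> f \<and> (\<forall>k u. opair k u \<^bold>\<in> f \<longrightarrow>
    k = empty \<and> u = x \<or> (\<exists>k' u'. k = succ k' \<and> u = G u' \<and> opair k' u' \<^bold>\<in> f)))" for k u
  note def = definability definable_term_app[OF G]
  have R_cases: "k = empty \<and> u = x \<or> (\<exists>k' u'. k = succ k' \<and> u = G u' \<and> R k' u')"
    if "R k u" for k u
    using that unfolding R_def by blast
  have R_succD: "\<exists>v. u = G v \<and> R k v" if "R (succ k) u" for k u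
    using R_cases[OF that] by auto
  have R_empty: "R empty x"
    unfolding R_def by (rule exI[of _ "upair (opair empty x) (opair empty x)"]) auto
  have R_succ: "R (succ k) (G u)" if Rku: "R k u" for k u
  proof -
    obtain f where f: "opair k u \<^bold>\<in> f" "\<forall>k u. opair k u \<^bold>\<in> f \<longrightarrow>
        k = empty \<and> u = x \<or> (\<exists>k' u'. k = succ k' \<and> u = G u' \<and> opair k' u' \<^bold>\<in> f)"
      using Rku unfolding R_def by blast
    let ?p = "opair (succ k) (G u)"
    show ?thesis
      unfolding R_def by (rule exI[of _ "cup f (upair ?p ?p)"]) (use f in auto)
  qed
  \<comment> \<open>This is the functionality that Replacement on \<open>omega\<close> requires in
    order to collect all iterates into \<open>Y\<close>.\<close>
  have R_unique: "\<forall>u u'. R k u \<longrightarrow> R k u' \<longrightarrow> u = u'" if "k \<^bold>\<in> omega" for k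
    using that
  proof (induction k rule: omega_induct)
    case definable
    show ?case unfolding R_def by (intro def)
  next
    case empty
    have "u = x" if "R empty u" for u using R_cases[OF that] by auto
    then show ?case by blast
  next
    case (succ k)
    show ?case
    proof (intro allI impI)
      fix u u' assume "R (succ k) u" "R (succ k) u'"
      then obtain v v' where "u = G v" "R k v" "u' = G v'" "R k v'"
        using R_succD by blast
      with succ.IH show "u = u'" by blast
    qed
  qed
  have "definable (\<lambda>e. R (e 0) (e 1))"
    unfolding R_def by (intro def)
  from replacement_definable[OF this, of omega] R_unique
  obtain Y where Y: "\<And>u. u \<^bold>\<in> Y \<longleftrightarrow> (\<exists>k. k \<^bold>\<in> omega \<and> R k u)" by blast
  show thesis
  proof (rule that)
    show "x \<^bold>\<in> Y" using R_empty empty_omega Y by blast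
    show "G u \<^bold>\<in> Y" if "u \<^bold>\<in> Y" for u using that R_succ succ_omega Y by blast
    fix P u assume P: "definable (\<lambda>e. P (e 0))" "P x" "\<And>u. u \<^bold>\<in> Y \<Longrightarrow> P u \<Longrightarrow> P (G u)" "u \<^bold>\<in> Y"
    have "\<forall>u. R k u \<longrightarrow> P u" if "k \<^bold>\<in> omega" for k
      using that
    proof (induction k rule: omega_induct)
      case definable
      show ?case unfolding R_def by (intro def P(1))
    next
      case empty
      then show ?case using R_cases[of empty] P(2) by auto
    next
      case (succ k)
      show ?case
      proof (intro allI impI)
        fix u assume "R (succ k) u"
        then obtain v where "u = G v" "R k v" using R_succD by blast
        with succ P(3) Y show "P u" by blast
      qed
    qed
    with P(4) Y show "P u" by blast
  qed
qed

section \<open>Transitive sets\<close>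

lemma transitive_set_mem: "transitive_set T \<Longrightarrow> x \<^bold>\<in> T \<Longrightarrow> y \<^bold>\<in> x \<Longrightarrow> y \<^bold>\<in> T"
  unfolding transitive_set_def subset_def by blast

text \<open>The transitive closure: the union of the iterates of \<open>bigcup\<close> starting from
  the singleton of \<open>x\<close>.\<close>

lemma transitive_superset:
  obtains T where "transitive_set T" "x \<^bold>\<in> T"
proof -
  obtain Y where Y: "upair x x \<^bold>\<in> Y" "\<And>u. u \<^bold>\<in> Y \<Longrightarrow> bigcup u \<^bold>\<in> Y"
    by (rule iterates_exist[of bigcup "upair x x"]) (intro definability, blast)
  show thesis
  proof (rule that)
    show "x \<^bold>\<in> bigcup Y" using Y(1) mem_bigcup by fastforce
    show "transitive_set (bigcup Y)"
      unfolding transitive_set_def subset_def using Y(2) mem_bigcup by blast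
  qed
qed

lemma transitive_set_opair:
  assumes "transitive_set T" "opair x y \<^bold>\<in> T"
  shows "upair x x \<^bold>\<in> T" "upair x y \<^bold>\<in> T" "x \<^bold>\<in> T" "y \<^bold>\<in> T"
  using transitive_set_mem[OF assms(1)] assms(2) unfolding opair_def by (metis mem_upair)+


section \<open>Formulas and satisfaction\<close>

lemmas code_defs = mem_code_def eq_code_def neg_code_def conj_code_def ex_code_def

text \<open>\<open>Form\<close> is an intersection, so it is a set only once some closed set is
  known. The stages obtained from \<open>omega\<close> by repeatedly adding all subsets are
  increasing: two elements of the union lie in a common stage, and their pair in the next
  one.\<close>

lemma formula_closed_exists:
  obtains K :: "'v::zf" where "formula_closed K"
proof -
  let ?G = "\<lambda>u::'v. cup u (pow u)"
  have G: "definable_term (\<lambda>e. ?G (e 0))" by (intro definability)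
  obtain Y where Y: "(omega :: 'v) \<^bold>\<in> Y" "\<And>u. u \<^bold>\<in> Y \<Longrightarrow> ?G u \<^bold>\<in> Y"
    and induct: "\<And>P u. definable (\<lambda>e. P (e 0)) \<Longrightarrow> P omega \<Longrightarrow>
      (\<And>u. u \<^bold>\<in> Y \<Longrightarrow> P u \<Longrightarrow> P (?G u)) \<Longrightarrow> u \<^bold>\<in> Y \<Longrightarrow> P u"
    by (rule iterates_exist[OF G, of omega]) blast
  have base: "subset omega u" if "u \<^bold>\<in> Y" for u
    by (rule induct[OF _ _ _ that]) (intro definability, auto simp: subset_def)
  have cases: "u = omega \<or> (\<exists>v. v \<^bold>\<in> Y \<and> u = ?G v)" if "u \<^bold>\<in> Y" for u
    by (rule induct[OF _ _ _ that]) (intro definability, auto)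
  \<comment> \<open>The stages carry no indices, so comparability is proved by induction over
    \<open>Y\<close>; a stage other than \<open>omega\<close> has a predecessor, and
    \<open>?G\<close> is monotone.\<close>
  have chain: "\<forall>v. v \<^bold>\<in> Y \<longrightarrow> subset u v \<or> subset v u" if "u \<^bold>\<in> Y" for u
  proof (rule induct[OF _ _ _ that])
    show "definable (\<lambda>e. \<forall>v. v \<^bold>\<in> Y \<longrightarrow> subset (e 0) v \<or> subset v (e 0))"
      by (intro definability)
    show "\<forall>v. v \<^bold>\<in> Y \<longrightarrow> subset omega v \<or> subset v omega" using base by blast
  next
    fix u assume u: "u \<^bold>\<in> Y" "\<forall>v. v \<^bold>\<in> Y \<longrightarrow> subset u v \<or> subset v u"
    show "\<forall>v. v \<^bold>\<in> Y \<longrightarrow> subset (?G u) v \<or> subset v (?G u)"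
    proof (intro allI impI)
      fix v assume "v \<^bold>\<in> Y"
      from cases[OF this] show "subset (?G u) v \<or> subset v (?G u)"
      proof
        assume "v = omega"
        then show ?thesis using base[OF Y(2)[OF u(1)]] by blast
      next
        assume "\<exists>w. w \<^bold>\<in> Y \<and> v = ?G w"
        then obtain w where w: "w \<^bold>\<in> Y" "v = ?G w" by blast
        then have "subset u w \<or> subset w u" using u(2) by blast
        then show ?thesis unfolding w(2) by (auto simp: subset_def)
      qed
    qed
  qed
  let ?K = "bigcup Y"
  have upair: "upair x y \<^bold>\<in> ?K" if "x \<^bold>\<in> ?K" "y \<^bold>\<in> ?K" for x y
  proof -
    obtain u v where "u \<^bold>\<in> Y" "x \<^bold>\<in> u" "v \<^bold>\<in> Y" "y \<^bold>\<in> v"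
      using \<open>x \<^bold>\<in> ?K\<close> \<open>y \<^bold>\<in> ?K\<close> unfolding mem_bigcup by blast
    then obtain w where w: "w \<^bold>\<in> Y" "x \<^bold>\<in> w" "y \<^bold>\<in> w"
      using chain[of u] unfolding subset_def by blast
    then have "upair x y \<^bold>\<in> ?G w" by (auto simp: subset_def)
    with Y(2)[OF w(1)] show ?thesis unfolding mem_bigcup by blast
  qed
  have omega: "n \<^bold>\<in> ?K" if "n \<^bold>\<in> omega" for n
    using that Y(1) unfolding mem_bigcup by blast
  have "opair x y \<^bold>\<in> ?K" if "x \<^bold>\<in> ?K" "y \<^bold>\<in> ?K" for x y
    unfolding opair_def by (intro upair that)
  moreover have "num n \<^bold>\<in> ?K" for n by (intro omega num_omega)
  ultimately have "formula_closed ?K"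
    unfolding formula_closed_def code_defs by (simp add: omega)
  then show thesis by (rule that)
qed

lemma definable_formula_closed: "definable (\<lambda>e. formula_closed (e i))"
  unfolding formula_closed_def code_defs by (intro definability)

lemma mem_Form: "p \<^bold>\<in> Form \<longleftrightarrow> (\<forall>X. formula_closed X \<longrightarrow> p \<^bold>\<in> X)"
proof -
  obtain K :: 'a where "formula_closed K" by (rule formula_closed_exists)
  then show ?thesis unfolding Form_def
    by (intro setof_iff comprehension[where x = K])
      (intro definability definable_formula_closed, blast)
qed

lemma
  shows mem_code_Form: "i \<^bold>\<in> omega \<Longrightarrow> j \<^bold>\<in> omega \<Longrightarrow> mem_code i j \<^bold>\<in> Form"
    and eq_code_Form: "i \<^bold>\<in> omega \<Longrightarrow> j \<^bold>\<in> omega \<Longrightarrow> eq_code i j \<^bold>\<in> Form"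
    and neg_code_Form: "p \<^bold>\<in> Form \<Longrightarrow> neg_code p \<^bold>\<in> Form"
    and conj_code_Form: "p \<^bold>\<in> Form \<Longrightarrow> q \<^bold>\<in> Form \<Longrightarrow> conj_code p q \<^bold>\<in> Form"
    and ex_code_Form: "i \<^bold>\<in> omega \<Longrightarrow> p \<^bold>\<in> Form \<Longrightarrow> ex_code i p \<^bold>\<in> Form"
  unfolding mem_Form by (auto simp: formula_closed_def)

lemmas Form_intros = mem_code_Form eq_code_Form neg_code_Form conj_code_Form ex_code_Form

text \<open>As for \<open>omega\<close>, the definable predicate cuts out a closed subset of
  \<open>Form\<close>; this reaches nonstandard codes too.\<close>

lemma Form_induct [consumes 1, case_names definable mem eq neg conj ex]:
  assumes "p \<^bold>\<in> Form" "definable (\<lambda>e. P (e 0))"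
    and "\<And>i j. i \<^bold>\<in> omega \<Longrightarrow> j \<^bold>\<in> omega \<Longrightarrow> P (mem_code i j)"
    and "\<And>i j. i \<^bold>\<in> omega \<Longrightarrow> j \<^bold>\<in> omega \<Longrightarrow> P (eq_code i j)"
    and "\<And>p. p \<^bold>\<in> Form \<Longrightarrow> P p \<Longrightarrow> P (neg_code p)"
    and "\<And>p q. p \<^bold>\<in> Form \<Longrightarrow> P p \<Longrightarrow> q \<^bold>\<in> Form \<Longrightarrow> P q \<Longrightarrow> P (conj_code p q)"
    and "\<And>i p. i \<^bold>\<in> omega \<Longrightarrow> p \<^bold>\<in> Form \<Longrightarrow> P p \<Longrightarrow> P (ex_code i p)"
  shows "P p"
proof -
  obtain X where X: "\<And>p. p \<^bold>\<in> X \<longleftrightarrow> p \<^bold>\<in> Form \<and> P p"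
    using comprehension[of "\<lambda>p. p \<^bold>\<in> Form \<and> P p" Form] assms(2)
      definable_conj[OF definable_mem[OF definable_term_var definable_term_const]] by blast
  have "formula_closed X"
    unfolding formula_closed_def X using assms(3-) by (auto intro: Form_intros)
  with assms(1) have "p \<^bold>\<in> X" unfolding mem_Form[of p] by blast
  then show ?thesis using X by blast
qed

section \<open>Existence and uniqueness of the satisfaction relation\<close>

text \<open>
  One step of Tarski's recursion. With separate clauses for negated formulas it is monotone in \<open>X\<close>,
  so the satisfaction relation can be obtained as a least fixed point.
\<close>

definition satisfaction_step :: "'v::zf \<Rightarrow> 'v \<Rightarrow> 'v \<Rightarrow> 'v \<Rightarrow> bool" where
  "satisfaction_step M X p s \<longleftrightarrow>
     (\<exists>i j u v. i \<^bold>\<in> omega \<and> j \<^bold>\<in> omega \<and> opair i u \<^bold>\<in> s \<and> opair j v \<^bold>\<in> s \<and>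
        (p = mem_code i j \<and> u \<^bold>\<in> v \<or> p = neg_code (mem_code i j) \<and> \<not> u \<^bold>\<in> v \<or>
         p = eq_code i j \<and> u = v \<or> p = neg_code (eq_code i j) \<and> u \<noteq> v)) \<or>
     (\<exists>q. p = neg_code (neg_code q) \<and> opair q s \<^bold>\<in> X) \<or>
     (\<exists>q r. p = conj_code q r \<and> opair q s \<^bold>\<in> X \<and> opair r s \<^bold>\<in> X) \<or>
     (\<exists>q r. p = neg_code (conj_code q r) \<and>
        (opair (neg_code q) s \<^bold>\<in> X \<or> opair (neg_code r) s \<^bold>\<in> X)) \<or>
     (\<exists>i q x. p = ex_code i q \<and> x \<^bold>\<in> M \<and> opair q (update s i x) \<^bold>\<in> X) \<or>
     (\<exists>i q. p = neg_code (ex_code i q) \<and>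
        (\<forall>x. x \<^bold>\<in> M \<longrightarrow> opair (neg_code q) (update s i x) \<^bold>\<in> X))"

text \<open>Unique readability: the tags are distinct numerals and pairing is injective, so a single
  clause applies to each shape.\<close>

lemma satisfaction_step_simps:
  shows "satisfaction_step M X (mem_code i j) s \<longleftrightarrow>
      (\<exists>u v. i \<^bold>\<in> omega \<and> j \<^bold>\<in> omega \<and> opair i u \<^bold>\<in> s \<and> opair j v \<^bold>\<in> s \<and> u \<^bold>\<in> v)"
    and "satisfaction_step M X (neg_code (mem_code i j)) s \<longleftrightarrow>
      (\<exists>u v. i \<^bold>\<in> omega \<and> j \<^bold>\<in> omega \<and> opair i u \<^bold>\<in> s \<and> opair j v \<^bold>\<in> s \<and> \<not> u \<^bold>\<in> v)"
    and "satisfaction_step M X (eq_code i j) s \<longleftrightarrow>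
      (\<exists>u v. i \<^bold>\<in> omega \<and> j \<^bold>\<in> omega \<and> opair i u \<^bold>\<in> s \<and> opair j v \<^bold>\<in> s \<and> u = v)"
    and "satisfaction_step M X (neg_code (eq_code i j)) s \<longleftrightarrow>
      (\<exists>u v. i \<^bold>\<in> omega \<and> j \<^bold>\<in> omega \<and> opair i u \<^bold>\<in> s \<and> opair j v \<^bold>\<in> s \<and> u \<noteq> v)"
    and "satisfaction_step M X (neg_code (neg_code p)) s \<longleftrightarrow> opair p s \<^bold>\<in> X"
    and "satisfaction_step M X (conj_code p q) s \<longleftrightarrow> opair p s \<^bold>\<in> X \<and> opair q s \<^bold>\<in> X"
    and "satisfaction_step M X (neg_code (conj_code p q)) s \<longleftrightarrow>
      opair (neg_code p) s \<^bold>\<in> X \<or> opair (neg_code q) s \<^bold>\<in> X"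
    and "satisfaction_step M X (ex_code i p) s \<longleftrightarrow> (\<exists>x. x \<^bold>\<in> M \<and> opair p (update s i x) \<^bold>\<in> X)"
    and "satisfaction_step M X (neg_code (ex_code i p)) s \<longleftrightarrow>
      (\<forall>x. x \<^bold>\<in> M \<longrightarrow> opair (neg_code p) (update s i x) \<^bold>\<in> X)"
  unfolding satisfaction_step_def code_defs by simp_all blast+

lemma satisfaction_step_mono:
  "satisfaction_step M X p s \<Longrightarrow> (\<And>z. z \<^bold>\<in> X \<Longrightarrow> z \<^bold>\<in> Y) \<Longrightarrow> satisfaction_step M Y p s"
  unfolding satisfaction_step_def by blast

lemma definable_satisfaction_step:
  "definable (\<lambda>e. satisfaction_step M (e i) (e j) (e k))"
  "definable (\<lambda>e. satisfaction_step M X (e j) (e k))"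
  unfolding satisfaction_step_def code_defs by (intro definability definable_update)+

text \<open>The Knaster-Tarski argument inside the universe: \<open>L\<close> is the intersection of
  all sets closed under the step. Quantifying over sets X is first-order, so \<open>L\<close> is
  obtained by comprehension.\<close>

lemma satisfaction_fixpoint:
  obtains L where "\<And>p s. opair p s \<^bold>\<in> L \<longleftrightarrow> p \<^bold>\<in> Form \<and> is_fun s omega M \<and> satisfaction_step M L p s"
    "\<And>r. r \<^bold>\<in> L \<Longrightarrow> r \<^bold>\<in> product Form (maps omega M)"
proof -
  let ?closed = "\<lambda>X. \<forall>p s. p \<^bold>\<in> Form \<and> is_fun s omega M \<and> satisfaction_step M X p s
    \<longrightarrow> opair p s \<^bold>\<in> X"
  have "\<exists>L. \<forall>r. r \<^bold>\<in> L \<longleftrightarrow> r \<^bold>\<in> product Form (maps omega M) \<and> (\<forall>X. ?closed X \<longrightarrow> r \<^bold>\<in> X)"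
    by (rule comprehension[where x = "product Form (maps omega M)"])
      (intro definability definable_is_fun definable_satisfaction_step, blast)
  then obtain L where L: "\<And>r. r \<^bold>\<in> L \<longleftrightarrow>
      r \<^bold>\<in> product Form (maps omega M) \<and> (\<forall>X. ?closed X \<longrightarrow> r \<^bold>\<in> X)" by blast
  have closed: "opair p s \<^bold>\<in> L"
    if ps: "p \<^bold>\<in> Form" "is_fun s omega M" "satisfaction_step M L p s" for p s
  proof -
    have "opair p s \<^bold>\<in> X" if X: "?closed X" for X
    proof -
      have "satisfaction_step M X p s"
        by (rule satisfaction_step_mono[OF ps(3)]) (use X L in blast)
      with X ps show ?thesis by blast
    qed
    with ps(1,2) show ?thesis unfolding L mem_product by auto
  qed
  have "\<exists>L'. \<forall>r. r \<^bold>\<in> L' \<longleftrightarrow> r \<^bold>\<in> L \<and> (\<exists>p s. r = opair p s \<and> satisfaction_step M L p s)"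
    by (rule comprehension[where x = L])
      (intro definability definable_satisfaction_step, blast)
  then obtain L' where L': "\<And>r. r \<^bold>\<in> L' \<longleftrightarrow>
      r \<^bold>\<in> L \<and> (\<exists>p s. r = opair p s \<and> satisfaction_step M L p s)" by blast
  \<comment> \<open>\<open>L'\<close> keeps the pairs of \<open>L\<close> that a step from
    \<open>L\<close> justifies. Being closed, it contains the least closed set \<open>L\<close>,
    which gives the other half of the fixed point equation.\<close>
  have "?closed L'"
  proof (intro allI impI, elim conjE)
    fix p s assume ps: "p \<^bold>\<in> Form" "is_fun s omega M" "satisfaction_step M L' p s"
    have "satisfaction_step M L p s"
      by (rule satisfaction_step_mono[OF ps(3)]) (use L' in blast)
    with closed[OF ps(1,2)] show "opair p s \<^bold>\<in> L'" unfolding L' by blast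
  qed
  then have "r \<^bold>\<in> L'" if "r \<^bold>\<in> L" for r using that L by blast
  then have step: "satisfaction_step M L p s" if "opair p s \<^bold>\<in> L" for p s
    using \<open>\<And>r. r \<^bold>\<in> L \<Longrightarrow> r \<^bold>\<in> L'\<close>[OF that] L'[of "opair p s"] by auto
  show thesis
  proof (rule that)
    show "r \<^bold>\<in> L \<Longrightarrow> r \<^bold>\<in> product Form (maps omega M)" for r using L by blast
    then show "opair p s \<^bold>\<in> L \<longleftrightarrow> p \<^bold>\<in> Form \<and> is_fun s omega M \<and> satisfaction_step M L p s" for p s
      using closed step by (fastforce simp: mem_product)
  qed
qed

lemma satisfaction_exists:
  obtains S where "satisfaction M S"
proof -
  obtain L where L: "\<And>p s. opair p s \<^bold>\<in> L \<longleftrightarrow>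
      p \<^bold>\<in> Form \<and> is_fun s omega M \<and> satisfaction_step M L p s"
    and L_sub: "\<And>r. r \<^bold>\<in> L \<Longrightarrow> r \<^bold>\<in> product Form (maps omega M)"
    using satisfaction_fixpoint[of M] by blast
  have step: "opair p s \<^bold>\<in> L \<longleftrightarrow> satisfaction_step M L p s"
    if "p \<^bold>\<in> Form" "is_fun s omega M" for p s
    using L that by blast
  have mem: "opair (mem_code i j) s \<^bold>\<in> L \<longleftrightarrow> app s i \<^bold>\<in> app s j"
    and neg_mem: "opair (neg_code (mem_code i j)) s \<^bold>\<in> L \<longleftrightarrow> \<not> app s i \<^bold>\<in> app s j"
    and eq: "opair (eq_code i j) s \<^bold>\<in> L \<longleftrightarrow> app s i = app s j"
    and neg_eq: "opair (neg_code (eq_code i j)) s \<^bold>\<in> L \<longleftrightarrow> app s i \<noteq> app s j"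
    if "is_fun s omega M" "i \<^bold>\<in> omega" "j \<^bold>\<in> omega" for i j s
    using that
    by (simp_all add: step Form_intros satisfaction_step_simps opair_mem_fun_iff[OF that(1)])
  have neg_neg: "opair (neg_code (neg_code p)) s \<^bold>\<in> L \<longleftrightarrow> opair p s \<^bold>\<in> L"
    if "is_fun s omega M" "p \<^bold>\<in> Form" for p s
    using that by (simp add: step Form_intros satisfaction_step_simps)
  have conj: "opair (conj_code p q) s \<^bold>\<in> L \<longleftrightarrow> opair p s \<^bold>\<in> L \<and> opair q s \<^bold>\<in> L"
    and neg_conj: "opair (neg_code (conj_code p q)) s \<^bold>\<in> L \<longleftrightarrow>
      opair (neg_code p) s \<^bold>\<in> L \<or> opair (neg_code q) s \<^bold>\<in> L"
    if "is_fun s omega M" "p \<^bold>\<in> Form" "q \<^bold>\<in> Form" for p q s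
    using that by (simp_all add: step Form_intros satisfaction_step_simps)
  have ex: "opair (ex_code i p) s \<^bold>\<in> L \<longleftrightarrow> (\<exists>x. x \<^bold>\<in> M \<and> opair p (update s i x) \<^bold>\<in> L)"
    and neg_ex: "opair (neg_code (ex_code i p)) s \<^bold>\<in> L \<longleftrightarrow>
      (\<forall>x. x \<^bold>\<in> M \<longrightarrow> opair (neg_code p) (update s i x) \<^bold>\<in> L)"
    if "is_fun s omega M" "i \<^bold>\<in> omega" "p \<^bold>\<in> Form" for i p s
    using that by (simp_all add: step[of "ex_code i p"] step[of "neg_code (ex_code i p)"]
      Form_intros satisfaction_step_simps)
  \<comment> \<open>The fixed point treats a formula and its negation separately; that exactly one
    of them holds is recovered by induction, for all assignments at once because the quantifier case
    changes them.\<close>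
  have neg: "\<forall>s. is_fun s omega M \<longrightarrow> (opair (neg_code p) s \<^bold>\<in> L \<longleftrightarrow> \<not> opair p s \<^bold>\<in> L)"
    if "p \<^bold>\<in> Form" for p
    using that
  proof (induction p rule: Form_induct)
    case definable
    show ?case unfolding neg_code_def by (intro definability definable_is_fun)
  qed (auto simp: mem neg_mem eq neg_eq neg_neg conj neg_conj ex neg_ex is_fun_update)
  have "\<exists>p s. r = opair p s \<and> p \<^bold>\<in> Form \<and> is_fun s omega M" if "r \<^bold>\<in> L" for r
    using L_sub[OF that] by (auto simp: mem_product)
  then have "satisfaction M L"
    unfolding satisfaction_def by (simp add: mem eq neg conj ex)
  then show thesis by (rule that)
qed

text \<open>Makes the existential quantifier over S in \<open>models\<close> harmless: truth can be
  read off from any one satisfaction relation.\<close>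

lemma satisfaction_unique:
  assumes "satisfaction M S" "satisfaction M S'"
  shows "S = S'"
proof (rule extensionality)
  have *: "\<forall>s. is_fun s omega M \<longrightarrow> (opair p s \<^bold>\<in> S \<longleftrightarrow> opair p s \<^bold>\<in> S')" if "p \<^bold>\<in> Form" for p
    using that
  proof (induction p rule: Form_induct)
    case definable
    show ?case by (intro definability definable_is_fun)
  qed (use assms in \<open>simp_all add: satisfaction_def is_fun_update cong: conj_cong\<close>)
  fix r
  have "\<exists>p s. r = opair p s \<and> p \<^bold>\<in> Form \<and> is_fun s omega M" if "r \<^bold>\<in> S \<or> r \<^bold>\<in> S'"
    using that assms unfolding satisfaction_def by blast
  then show "r \<^bold>\<in> S \<longleftrightarrow> r \<^bold>\<in> S'"
    using * by blast
qed

lemma models_iff: "satisfaction M S \<Longrightarrow> models M p s \<longleftrightarrow> opair p s \<^bold>\<in> S"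
  unfolding models_def using satisfaction_unique by blast

lemma
  assumes "is_fun s omega M"
  shows models_mem: "i \<^bold>\<in> omega \<Longrightarrow> j \<^bold>\<in> omega \<Longrightarrow> models M (mem_code i j) s \<longleftrightarrow> app s i \<^bold>\<in> app s j"
    and models_eq: "i \<^bold>\<in> omega \<Longrightarrow> j \<^bold>\<in> omega \<Longrightarrow> models M (eq_code i j) s \<longleftrightarrow> app s i = app s j"
    and models_neg: "p \<^bold>\<in> Form \<Longrightarrow> models M (neg_code p) s \<longleftrightarrow> \<not> models M p s"
    and models_conj: "p \<^bold>\<in> Form \<Longrightarrow> q \<^bold>\<in> Form \<Longrightarrow>
      models M (conj_code p q) s \<longleftrightarrow> models M p s \<and> models M q s"
    and models_ex: "i \<^bold>\<in> omega \<Longrightarrow> p \<^bold>\<in> Form \<Longrightarrow>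
      models M (ex_code i p) s \<longleftrightarrow> (\<exists>x. x \<^bold>\<in> M \<and> models M p (update s i x))"
proof -
  obtain S where "satisfaction M S" by (rule satisfaction_exists)
  then show "i \<^bold>\<in> omega \<Longrightarrow> j \<^bold>\<in> omega \<Longrightarrow> models M (mem_code i j) s \<longleftrightarrow> app s i \<^bold>\<in> app s j"
    and "i \<^bold>\<in> omega \<Longrightarrow> j \<^bold>\<in> omega \<Longrightarrow> models M (eq_code i j) s \<longleftrightarrow> app s i = app s j"
    and "p \<^bold>\<in> Form \<Longrightarrow> models M (neg_code p) s \<longleftrightarrow> \<not> models M p s"
    and "p \<^bold>\<in> Form \<Longrightarrow> q \<^bold>\<in> Form \<Longrightarrow> models M (conj_code p q) s \<longleftrightarrow> models M p s \<and> models M q s"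
    and "i \<^bold>\<in> omega \<Longrightarrow> p \<^bold>\<in> Form \<Longrightarrow>
      models M (ex_code i p) s \<longleftrightarrow> (\<exists>x. x \<^bold>\<in> M \<and> models M p (update s i x))"
    using assms by (simp_all add: models_iff satisfaction_def)
qed


section \<open>Elementary embeddings\<close>

lemma assignment_exists:
  assumes "x \<^bold>\<in> N" "y \<^bold>\<in> N" "z \<^bold>\<in> N"
  obtains s where "is_fun s omega N" "app s (num 0) = x" "app s (num 1) = y" "app s (num 2) = z"
proof -
  \<comment> \<open>Assignments are total on \<open>omega\<close>, so all remaining variables
    receive the default \<open>x\<close>.\<close>
  let ?c = "product omega (upair x x)"
  have "p \<^bold>\<in> ?c \<longleftrightarrow> (\<exists>i. i \<^bold>\<in> omega \<and> p = opair i x)" for p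
    by (auto simp: mem_product)
  from is_funI(1)[OF this assms(1)] have c: "is_fun ?c omega N" .
  let ?s = "update (update (update ?c (num 0) x) (num 1) y) (num 2) z"
  show thesis
    by (rule that[of ?s])
      (use assms c in \<open>simp_all add: is_fun_update app_update[where A = omega and B = N]\<close>)
qed

text \<open>Converts preservation of the code \<open>p\<close> into preservation of the HOL
  predicate \<open>Q\<close> it expresses. Variables 0 to 2 carry the arguments, and callers repeat
  an argument to fill a vacant place; variable 3 serves below as the bound one.\<close>

lemma elementary_transfer:
  assumes j: "elementary_embedding j N N" and "p \<^bold>\<in> Form" "x \<^bold>\<in> N" "y \<^bold>\<in> N" "z \<^bold>\<in> N"
    and Q: "\<And>s. is_fun s omega N \<Longrightarrow>
      models N p s \<longleftrightarrow> Q (app s (num 0)) (app s (num 1)) (app s (num 2))"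
  shows "Q x y z \<longleftrightarrow> Q (app j x) (app j y) (app j z)"
proof -
  obtain s where s: "is_fun s omega N" "app s (num 0) = x" "app s (num 1) = y" "app s (num 2) = z"
    using assignment_exists assms(3-5) .
  have j_fun: "is_fun j N N" using j by (simp add: elementary_embedding_def)
  have "models N p s \<longleftrightarrow> models N p (compose j s)"
    using j assms(2) s(1) by (simp add: elementary_embedding_def)
  then show ?thesis
    using s by (simp add: Q is_fun_compose[OF s(1) j_fun] app_compose[OF s(1) j_fun])
qed

section \<open>Elementary self-embeddings of a transitive set\<close>

context
  fixes j N :: "'v::zf"
  assumes j: "elementary_embedding j N N" and N: "transitive_set N"
begin

lemmas models_simps = models_mem models_eq models_neg models_conj models_ex Form_intros
  is_fun_update app_update[where A = omega and B = N]

lemma embedding_in: "x \<^bold>\<in> N \<Longrightarrow> app j x \<^bold>\<in> N"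
  using j by (auto simp: elementary_embedding_def intro: app_mem)

lemma embedding_mem:
  assumes "x \<^bold>\<in> N" "y \<^bold>\<in> N"
  shows "x \<^bold>\<in> y \<longleftrightarrow> app j x \<^bold>\<in> app j y"
proof (rule elementary_transfer[OF j, where x = x and y = y and z = x
      and Q = "\<lambda>x y z. x \<^bold>\<in> y"])
  show "models N (mem_code (num 0) (num 1)) s \<longleftrightarrow> app s (num 0) \<^bold>\<in> app s (num 1)"
    if "is_fun s omega N" for s
    using that by (simp add: models_simps)
qed (use assms in \<open>simp_all add: Form_intros\<close>)

lemma embedding_contained:
  assumes "x \<^bold>\<in> N"
  shows "(\<exists>w. w \<^bold>\<in> N \<and> x \<^bold>\<in> w) \<longleftrightarrow> (\<exists>w. w \<^bold>\<in> N \<and> app j x \<^bold>\<in> w)"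
proof (rule elementary_transfer[OF j, where x = x and y = x and z = x
      and Q = "\<lambda>x y z. \<exists>w. w \<^bold>\<in> N \<and> x \<^bold>\<in> w"])
  show "models N (ex_code (num 3) (mem_code (num 0) (num 3))) s \<longleftrightarrow>
      (\<exists>w. w \<^bold>\<in> N \<and> app s (num 0) \<^bold>\<in> w)" if "is_fun s omega N" for s
    using that by (simp add: models_simps cong: conj_cong)
qed (use assms in \<open>simp_all add: Form_intros\<close>)

text \<open>Transitivity of \<open>N\<close> puts every counterexample to inclusion into
  \<open>N\<close>, so the formula evaluated in \<open>N\<close> expresses true inclusion.\<close>

lemma embedding_subset:
  assumes "x \<^bold>\<in> N" "y \<^bold>\<in> N"
  shows "subset (app j x) (app j y) \<longleftrightarrow> subset x y"
proof -
  have "(\<exists>w. w \<^bold>\<in> N \<and> w \<^bold>\<in> x \<and> \<not> w \<^bold>\<in> y) \<longleftrightarrow>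
      (\<exists>w. w \<^bold>\<in> N \<and> w \<^bold>\<in> app j x \<and> \<not> w \<^bold>\<in> app j y)"
  proof (rule elementary_transfer[OF j, where x = x and y = y and z = x
      and Q = "\<lambda>x y z. \<exists>w. w \<^bold>\<in> N \<and> w \<^bold>\<in> x \<and> \<not> w \<^bold>\<in> y"])
    show "models N (ex_code (num 3)
          (conj_code (mem_code (num 3) (num 0)) (neg_code (mem_code (num 3) (num 1))))) s \<longleftrightarrow>
        (\<exists>w. w \<^bold>\<in> N \<and> w \<^bold>\<in> app s (num 0) \<and> \<not> w \<^bold>\<in> app s (num 1))"
      if "is_fun s omega N" for s
      using that by (simp add: models_simps cong: conj_cong)
  qed (use assms in \<open>simp_all add: Form_intros\<close>)
  then show ?thesis
    using transitive_set_mem[OF N assms(1)] transitive_set_mem[OF N embedding_in[OF assms(1)]]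
    unfolding subset_def by blast
qed

lemma embedding_empty:
  assumes "empty \<^bold>\<in> N"
  shows "app j empty = empty"
proof -
  have "(\<exists>w. w \<^bold>\<in> N \<and> w \<^bold>\<in> empty) \<longleftrightarrow> (\<exists>w. w \<^bold>\<in> N \<and> w \<^bold>\<in> app j empty)"
  proof (rule elementary_transfer[OF j, where x = empty and y = empty and z = empty
      and Q = "\<lambda>x y z. \<exists>w. w \<^bold>\<in> N \<and> w \<^bold>\<in> x"])
    show "models N (ex_code (num 3) (mem_code (num 3) (num 0))) s \<longleftrightarrow>
        (\<exists>w. w \<^bold>\<in> N \<and> w \<^bold>\<in> app s (num 0))" if "is_fun s omega N" for s
      using that by (simp add: models_simps cong: conj_cong)
  qed (use assms in \<open>simp_all add: Form_intros\<close>)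
  then show ?thesis
    using transitive_set_mem[OF N embedding_in[OF assms]] by (intro extensionality) auto
qed

text \<open>The formula only excludes a third element; that both images belong to the image of the
  pair comes from preservation of membership.\<close>

lemma embedding_upair:
  assumes "x \<^bold>\<in> N" "y \<^bold>\<in> N" "upair x y \<^bold>\<in> N"
  shows "app j (upair x y) = upair (app j x) (app j y)"
proof -
  have "(\<exists>w. w \<^bold>\<in> N \<and> w \<^bold>\<in> upair x y \<and> w \<noteq> x \<and> w \<noteq> y) \<longleftrightarrow>
      (\<exists>w. w \<^bold>\<in> N \<and> w \<^bold>\<in> app j (upair x y) \<and> w \<noteq> app j x \<and> w \<noteq> app j y)"
  proof (rule elementary_transfer[OF j, where x = x and y = y and z = "upair x y"
      and Q = "\<lambda>x y z. \<exists>w. w \<^bold>\<in> N \<and> w \<^bold>\<in> z \<and> w \<noteq> x \<and> w \<noteq> y"])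
    show "models N (ex_code (num 3) (conj_code (mem_code (num 3) (num 2)) (conj_code
          (neg_code (eq_code (num 3) (num 0))) (neg_code (eq_code (num 3) (num 1)))))) s \<longleftrightarrow>
        (\<exists>w. w \<^bold>\<in> N \<and> w \<^bold>\<in> app s (num 2) \<and> w \<noteq> app s (num 0) \<and> w \<noteq> app s (num 1))"
      if "is_fun s omega N" for s
      using that by (simp add: models_simps cong: conj_cong)
  qed (use assms in \<open>simp_all add: Form_intros\<close>)
  moreover have "app j x \<^bold>\<in> app j (upair x y)" "app j y \<^bold>\<in> app j (upair x y)"
    using assms by (simp_all flip: embedding_mem)
  ultimately show ?thesis
    using transitive_set_mem[OF N embedding_in[OF assms(3)]] by (intro extensionality) auto
qed

lemma embedding_succ:
  assumes "x \<^bold>\<in> N" "succ x \<^bold>\<in> N"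
  shows "app j (succ x) = succ (app j x)"
proof -
  have "(\<exists>w. w \<^bold>\<in> N \<and> w \<^bold>\<in> succ x \<and> \<not> w \<^bold>\<in> x \<and> w \<noteq> x) \<longleftrightarrow>
      (\<exists>w. w \<^bold>\<in> N \<and> w \<^bold>\<in> app j (succ x) \<and> \<not> w \<^bold>\<in> app j x \<and> w \<noteq> app j x)"
  proof (rule elementary_transfer[OF j, where x = x and y = "succ x" and z = x
      and Q = "\<lambda>x y z. \<exists>w. w \<^bold>\<in> N \<and> w \<^bold>\<in> y \<and> \<not> w \<^bold>\<in> x \<and> w \<noteq> x"])
    show "models N (ex_code (num 3) (conj_code (mem_code (num 3) (num 1)) (conj_code
          (neg_code (mem_code (num 3) (num 0))) (neg_code (eq_code (num 3) (num 0)))))) s \<longleftrightarrow>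
        (\<exists>w. w \<^bold>\<in> N \<and> w \<^bold>\<in> app s (num 1) \<and> \<not> w \<^bold>\<in> app s (num 0) \<and> w \<noteq> app s (num 0))"
      if "is_fun s omega N" for s
      using that by (simp add: models_simps cong: conj_cong)
  qed (use assms in \<open>simp_all add: Form_intros\<close>)
  moreover have "app j x \<^bold>\<in> app j (succ x)"
    using assms by (simp flip: embedding_mem)
  moreover have "subset (app j x) (app j (succ x))"
    using assms by (simp add: embedding_subset) (simp add: subset_def)
  ultimately show ?thesis
    using transitive_set_mem[OF N embedding_in[OF assms(2)]]
    by (intro extensionality) (auto simp: subset_def)
qed

lemma embedding_opair:
  assumes "opair x y \<^bold>\<in> N"
  shows "app j (opair x y) = opair (app j x) (app j y)"
  using assms transitive_set_opair[OF N assms] unfolding opair_def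
  by (simp add: embedding_upair)

lemma embedding_fixes_Form:
  assumes "subset Form N"
  shows "k \<^bold>\<in> omega \<Longrightarrow> app j k = k" and "p \<^bold>\<in> Form \<Longrightarrow> app j p = p"
proof -
  have Form_N: "p \<^bold>\<in> N" if "p \<^bold>\<in> Form" for p
    using that assms by (simp add: subset_def)
  \<comment> \<open>A number k occurs inside the code \<open>mem_code k k\<close>, and
    \<open>N\<close> is transitive.\<close>
  have omega_N: "k \<^bold>\<in> N" if "k \<^bold>\<in> omega" for k
    using transitive_set_opair[OF N] Form_N[OF mem_code_Form[OF that that]]
    unfolding mem_code_def by blast
  have app_iff: "opair x x \<^bold>\<in> j \<longleftrightarrow> app j x = x" if "x \<^bold>\<in> N" for x
    using opair_mem_fun_iff[of j N N x x] j that by (simp add: elementary_embedding_def)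
  \<comment> \<open>Being fixed is written as membership of a pair in the set \<open>j\<close>,
    which is visibly definable, unlike \<open>app\<close> with its description operator.\<close>
  have omega: "opair k k \<^bold>\<in> j" if "k \<^bold>\<in> omega" for k
    using that
  proof (induction k rule: omega_induct)
    case definable
    show ?case by (intro definability)
  qed (simp_all add: app_iff omega_N embedding_empty embedding_succ)
  then show omega: "app j k = k" if "k \<^bold>\<in> omega" for k
    using that by (simp add: app_iff omega_N)
  note code_N = Form_intros[THEN Form_N, unfolded code_defs One_nat_def]
  \<comment> \<open>Every code except a negation contains an inner pair, which must also be in
    \<open>N\<close> before \<open>embedding_opair\<close> can be applied to it.\<close>
  note opair_N = transitive_set_opair(4)[OF N]
  have "opair p p \<^bold>\<in> j" if "p \<^bold>\<in> Form" for p
    using that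
  proof (induction p rule: Form_induct)
    case definable
    show ?case by (intro definability)
  qed (simp_all add: app_iff Form_N Form_intros,
      simp_all add: code_defs embedding_opair code_N opair_N[OF code_N(1)] opair_N[OF code_N(2)]
        opair_N[OF code_N(4)] opair_N[OF code_N(5)] omega)
  then show "app j p = p" if "p \<^bold>\<in> Form" for p
    using that by (simp add: app_iff Form_N)
qed

lemma restrict_elementary:
  assumes S: "satisfaction M S" and MS: "opair M S \<^bold>\<in> N" "app j (opair M S) = opair M S"
    and Form: "subset Form N"
  shows "elementary_embedding (restrict j M) M M"
proof -
  let ?r = "restrict j M"
  have jM: "app j M = M" and jS: "app j S = S"
    using embedding_opair[OF MS(1)] MS(2) by simp_all
  have M_N: "M \<^bold>\<in> N" and S_N: "S \<^bold>\<in> N"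
    using transitive_set_opair[OF N MS(1)] by simp_all
  have x_N: "x \<^bold>\<in> N" if "x \<^bold>\<in> M" for x
    using transitive_set_mem[OF N M_N that] .
  have j_M: "app j x \<^bold>\<in> M" if "x \<^bold>\<in> M" for x
    using embedding_mem[OF x_N[OF that] M_N] that jM by simp
  have j_fun: "is_fun j N N" using j by (simp add: elementary_embedding_def)
  have "subset M N" using x_N by (simp add: subset_def)
  then have r: "is_fun ?r M M" "\<And>x. x \<^bold>\<in> M \<Longrightarrow> app ?r x = app j x"
    using is_fun_restrict[OF j_fun] app_restrict[OF j_fun] j_M by blast+
  have step: "opair p (compose ?r s) \<^bold>\<in> S"
    if p: "p \<^bold>\<in> Form" and s: "is_fun s omega M" and ps: "opair p s \<^bold>\<in> S" for p s
  proof -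
    have ps_N: "opair p s \<^bold>\<in> N" by (rule transitive_set_mem[OF N S_N ps])
    \<comment> \<open>An assignment in \<open>M\<close> is known to lie in \<open>N\<close> only
      through a pair in \<open>S\<close>; hence the argument starts from a true formula.\<close>
    then have s_N: "s \<^bold>\<in> N" by (rule transitive_set_opair[OF N])
    have js: "opair p (app j s) \<^bold>\<in> S"
      using embedding_mem[OF ps_N S_N] ps jS embedding_opair[OF ps_N]
        embedding_fixes_Form(2)[OF Form p] by simp
    \<comment> \<open>\<open>S\<close> contains only pairs whose second component is an assignment
      in \<open>M\<close>.\<close>
    then have js_fun: "is_fun (app j s) omega M"
      using S unfolding satisfaction_def by fastforce
    have "app j s = compose ?r s"
    proof (rule fun_eqI[OF js_fun is_fun_compose[OF s r(1)]])
      fix i :: 'v assume i: "i \<^bold>\<in> omega"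
      have ix: "opair i (app s i) \<^bold>\<in> s" using opair_mem_fun_iff[OF s i] by simp
      have ix_N: "opair i (app s i) \<^bold>\<in> N" by (rule transitive_set_mem[OF N s_N ix])
      have "opair i (app j (app s i)) \<^bold>\<in> app j s"
        using embedding_mem[OF ix_N s_N] ix embedding_opair[OF ix_N]
          embedding_fixes_Form(1)[OF Form i] by simp
      then show "app (app j s) i = app (compose ?r s) i"
        using opair_mem_fun_iff[OF js_fun i] app_compose[OF s r(1) i] r(2)[OF app_mem[OF s i]]
        by simp
    qed
    with js show ?thesis by simp
  qed
  have "models M p s \<longleftrightarrow> models M p (compose ?r s)" if p: "p \<^bold>\<in> Form" and s: "is_fun s omega M" for p s
  proof
    show "models M p (compose ?r s)" if "models M p s"
      using step[OF p s] that by (simp add: models_iff[OF S])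
    show "models M p s" if "models M p (compose ?r s)"
    proof (rule ccontr)
      assume "\<not> models M p s"
      then have "models M (neg_code p) s" using p s by (simp add: models_neg)
      then have "models M (neg_code p) (compose ?r s)"
        using step[OF neg_code_Form[OF p] s] by (simp add: models_iff[OF S])
      then show False using that p is_fun_compose[OF s r(1)] by (simp add: models_neg)
    qed
  qed
  then show ?thesis unfolding elementary_embedding_def using r(1) by blast
qed

end

section \<open>Construction of the accessed world\<close>

lemma definable_element_fixed:
  fixes T c :: "'v::zf"
  defines "q \<equiv> upair T c"
  defines "N \<equiv> cup T (upair T q)"
  assumes T: "transitive_set T" and c: "c \<^bold>\<in> T"
  shows "transitive_set N"
    and "elementary_embedding j N N \<Longrightarrow> app j c = c"
proof -
  have mem_N: "x \<^bold>\<in> N \<longleftrightarrow> x \<^bold>\<in> T \<or> x = T \<or> x = q" for x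
    by (auto simp: N_def)
  have mem_q: "x \<^bold>\<in> q \<longleftrightarrow> x = T \<or> x = c" for x
    by (simp add: q_def)
  show tr: "transitive_set N"
    unfolding transitive_set_def subset_def mem_N
    using transitive_set_mem[OF T] c by (auto simp: mem_q)
  assume j: "elementary_embedding j N N"
  have in_N: "q \<^bold>\<in> N" "T \<^bold>\<in> N" "c \<^bold>\<in> N" using c by (auto simp: mem_N)
  have "\<not> q \<^bold>\<in> w" if "w \<^bold>\<in> N" for w
  proof
    assume "q \<^bold>\<in> w"
    then have "q \<^bold>\<in> T"
      using that transitive_set_mem[OF T] not_mem_self by (auto simp: mem_N)
    then show False using not_mem_cycle[of q T] by (simp add: mem_q)
  qed
  then have "\<not> app j q \<^bold>\<in> T" "\<not> app j q \<^bold>\<in> q"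
    using embedding_contained[OF j tr in_N(1)] in_N by blast+
  \<comment> \<open>The image of \<open>q\<close> belongs to no element of \<open>N\<close>. It is
    therefore not in \<open>T\<close>, and not equal to \<open>T\<close> because \<open>T\<close> is
    an element of \<open>q\<close>; only \<open>q\<close> is left.\<close>
  then have jq: "app j q = q"
    using embedding_in[OF j tr in_N(1)] by (auto simp: mem_N mem_q)
  have "app j T \<^bold>\<in> q" "app j c \<^bold>\<in> q" "app j c \<^bold>\<in> app j T"
    using embedding_mem[OF j tr] in_N c jq by (metis mem_q)+
  \<comment> \<open>If \<open>c\<close> went to \<open>T\<close>, then \<open>T\<close> would belong
    to the image of \<open>T\<close>, which is \<open>T\<close> or \<open>c\<close>; either way
    there is a membership cycle.\<close>
  then show "app j c = c"
    using c not_mem_self not_mem_cycle unfolding mem_q by metis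
qed

theorem lemma2p3:
  fixes \<delta> :: "'v :: zf"
  assumes "berkeley \<delta>"
  shows "(\<forall>M. world \<delta> M \<longrightarrow> substructure (set_structure M) universe) \<and>
         (\<forall>M a. world \<delta> M \<longrightarrow> (\<exists>N. world \<delta> N \<and> accesses M N \<and> a \<^bold>\<in> N))"
proof (intro conjI allI impI)
  fix M assume "world \<delta> M"
  then show "substructure (set_structure M) universe"
    by (auto simp: world_def substructure_def set_structure_def universe_def)
next
  fix M a assume M: "world \<delta> M"
  obtain S where S: "satisfaction M S" by (rule satisfaction_exists)
  \<comment> \<open>A single set from which transitivity recovers \<open>M\<close>,
    \<open>S\<close>, \<open>Form\<close> and \<open>a\<close>; as elements of \<open>T\<close>, the
    sets \<open>M\<close> and \<open>Form\<close> are also subsets of it.\<close>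
  obtain T where T: "transitive_set T" "upair (opair M S) (upair Form a) \<^bold>\<in> T"
    by (rule transitive_superset)
  note T_mem = transitive_set_mem[OF T(1)]
  have in_T: "opair M S \<^bold>\<in> T" "Form \<^bold>\<in> T" "a \<^bold>\<in> T"
    using T_mem[OF T(2)] T_mem by (metis mem_upair)+
  have M_T: "M \<^bold>\<in> T" by (rule transitive_set_opair[OF T(1) in_T(1)])
  let ?N = "cup T (upair T (upair T (opair M S)))"
  note N = definable_element_fixed[OF T(1) in_T(1)]
  show "\<exists>N. world \<delta> N \<and> accesses M N \<and> a \<^bold>\<in> N"
  proof (intro exI conjI)
    show "world \<delta> ?N"
      using N(1) M T_mem[OF M_T] by (simp add: world_def)
    show "a \<^bold>\<in> ?N" using in_T(3) by simp
    have "elementary_embedding (restrict j M) M M" if j: "elementary_embedding j ?N ?N" for j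
      using restrict_elementary[OF j N(1) S _ N(2)[OF j]] in_T T_mem[OF in_T(2)]
      by (simp add: subset_def)
    moreover have "subset M ?N" using T_mem[OF M_T] by (simp add: subset_def)
    ultimately show "accesses M ?N" by (simp add: accesses_def)
  qed
qed

end
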